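(* Consider the repeated newsvendor with horizon $T$, actions $X_t\in[0,B]$, demands $D_t\in[0,B]$ almost surely, and observations $O_t=\psi(X_t,D_t)=(\min\{D_t,X_t\},\mathbf{1}\{D_t\le X_t\})$; $H_t=((X_s,O_s))_{s\le t}$. Let $\mathbb{P}^\star$ be the true environment, $\pi_\theta$ a deployed policy, and $\mathbb{P}^\star_{\pi_\theta}$ the induced interaction law. For each $t$ and history $h$, let $Q_t^\star(\cdot\mid h)$ be the true law of $D_{1:T}$ given $H_{t-1}=h$ and $Q_{t,\theta}(\cdot\mid h)$ a learned law on $[0,B]^T$; let $q_t^\star(\cdot\mid h)$ and $q_{t,\theta}(\cdot\mid h)$ be the corresponding laws of the time-$t$ coordinate. Assume both $Q_t^\star(\cdot\mid h)$ and $Q_{t,\theta}(\cdot\mid h)$ are given by autoregressive factorizations over the $T$ coordinates in a common generation order whose first generated coordinate is the time-$t$ demand: $Q^\star_t(d\tilde d_{1:T}\mid h)=q^\star_{t,1}(d\tilde d_1\mid h)\prod_{s=2}^T q^\star_{t,s}(d\tilde d_s\mid h,\tilde d_{1:s-1})$ and likewise for $Q_{t,\theta}$ with kernels $q_{t,s,\theta}$, so that $q^\star_{t,1}=q^\star_t$ and $q_{t,1,\theta}=q_{t,\theta}$. Define $d(h)=\mathrm{KL}(q^\star_{t,1}(\cdot\mid h)\|q_{t,1,\theta}(\cdot\mid h))$ and, for $s\ge2$, $\delta_s(h)=\mathbb{E}_{\tilde D_{1:s-1}\sim Q_t^\star(\cdot\mid h)}[\mathrm{KL}(q^\star_{t,s}(\cdot\mid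 h,\tilde D_{1:s-1})\|q_{t,s,\theta}(\cdot\mid h,\tilde D_{1:s-1}))]$. For $x\in[0,B]$ let $P^{\mathrm{obs}}_{h,x}$ and $Q^{\mathrm{obs}}_{h,x}$ be the pushforwards of $q_t^\star(\cdot\mid h)$ and $q_{t,\theta}(\cdot\mid h)$ under $d\mapsto\psi(x,d)$. Define $$\Delta_T^{\mathrm{comp}}(\theta;\pi_\theta)=\sum_{t=1}^T\mathbb{E}_{H_{t-1}\sim\mathbb{P}^\star_{\pi_\theta}}\big[\mathrm{KL}(Q_t^\star(\cdot\mid H_{t-1})\|Q_{t,\theta}(\cdot\mid H_{t-1}))\big],\quad \Delta_T^{\mathrm{obs}}(\theta;\pi_\theta)=\sum_{t=1}^T\mathbb{E}_{(H_{t-1},X_t)\sim\mathbb{P}^\star_{\pi_\theta}}\big[\mathrm{KL}(P^{\mathrm{obs}}_{H_{t-1},X_t}\|Q^{\mathrm{obs}}_{H_{t-1},X_t})\big].$$ Assume that for $\mathbb{P}^\star_{\pi_\theta}$-a.e. history $h$ and all $t$: (1) $\mathbb{P}^\star_{\pi_\theta}(X_t=B\mid H_{t-1}=h)\ge\eta$ for some $\eta>0$; and (2) $\delta_s(h)\le(c_{\mathrm{sc}}/s)\,d(h)$ for all $s\ge2$, for some constant $c_{\mathrm{sc}}\in(0,\infty)$. Then $$\Delta_T^{\mathrm{comp}}(\theta;\pi_\theta)\le\frac{1+c_{\mathrm{sc}}\log T}{\eta}\,\Delta_T^{\mathrm{obs}}(\theta;\pi_\theta).$$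
   Context: KL denotes Kullback–Leibler divergence. The learned kernel $Q_{t,\theta}(\cdot\mid h)$ is the law of the completion sampled at round $t$ by the deployed policy. *)

theory Defs
  imports "HOL-Probability.Probability"
begin

text \<open>KL(P || Q) for probability measures P, Q on a common measurable space:
  if P is absolutely continuous w.r.t. Q with density f = dP/dQ, then
  KL(P||Q) = integral of (f ln f - f + 1) dQ (which equals the integral of f ln f dQ,
  and is +infinity if that integral diverges); otherwise KL(P||Q) = +infinity.
  Natural logarithm.\<close>

definition KL :: "'a measure \<Rightarrow> 'a measure \<Rightarrow> ennreal" where
  "KL P Q =
     (if absolutely_continuous Q P
      then (\<integral>\<^sup>+ x. ennreal (let f = enn2real (RN_deriv Q P x) in f * ln f - f + 1) \<partial>Q)
      else \<infinity>)"

definition psi :: "real \<Rightarrow> real \<Rightarrow> real \<times> bool" where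
  "psi x d = (min d x, d \<le> x)"

definition Osp :: "(real \<times> bool) measure" where
  "Osp = borel \<Otimes>\<^sub>M count_space UNIV"

definition Dsp :: "nat \<Rightarrow> (nat \<Rightarrow> real) measure" where
  "Dsp T = PiM {1..T} (\<lambda>_. borel)"

definition Hsp :: "nat \<Rightarrow> (nat \<Rightarrow> real \<times> real \<times> bool) measure" where
  "Hsp t = PiM {1..<t} (\<lambda>_. borel \<Otimes>\<^sub>M Osp)"

definition hist :: "(nat \<Rightarrow> 'w \<Rightarrow> real) \<Rightarrow> (nat \<Rightarrow> 'w \<Rightarrow> real) \<Rightarrow> nat \<Rightarrow> 'w
                     \<Rightarrow> (nat \<Rightarrow> real \<times> real \<times> bool)" where
  "hist X D t \<omega> = (\<lambda>s\<in>{1..<t}. (X s \<omega>, psi (X s \<omega>) (D s \<omega>)))"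

definition dpath :: "nat \<Rightarrow> (nat \<Rightarrow> 'w \<Rightarrow> real) \<Rightarrow> 'w \<Rightarrow> (nat \<Rightarrow> real)" where
  "dpath T D \<omega> = (\<lambda>i\<in>{1..T}. D i \<omega>)"

text \<open>Prefix d_{1:s-1} of a (generation-order) path, other coordinates set to 0.\<close>
definition trunc :: "nat \<Rightarrow> nat \<Rightarrow> (nat \<Rightarrow> real) \<Rightarrow> (nat \<Rightarrow> real)" where
  "trunc T s y = (\<lambda>i\<in>{1..T}. if i < s then y i else 0)"

text \<open>Law of the first s generated coordinates (in generation order) of the
  autoregressive model with kernels k s (d_{1:s-1}); ar_law T k T is the
  full law  k 1 (dd_1) * prod_{s=2}^T k s (dd_s | d_{1:s-1}).\<close>
fun ar_law :: "nat \<Rightarrow> (nat \<Rightarrow> (nat \<Rightarrow> real) \<Rightarrow> real measure) \<Rightarrow> nat \<Rightarrow> (nat \<Rightarrow> real) measure" where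
  "ar_law T k 0 = return (Dsp T) (\<lambda>i\<in>{1..T}. 0)"
| "ar_law T k (Suc s) =
     bind (ar_law T k s)
       (\<lambda>y. distr (k (Suc s) (trunc T (Suc s) y)) (Dsp T) (\<lambda>z. y(Suc s := z)))"

text \<open>Reorder a generation-order path y into time order: the s-th generated
  coordinate is the demand at time sigma s.\<close>
definition to_time :: "nat \<Rightarrow> (nat \<Rightarrow> nat) \<Rightarrow> (nat \<Rightarrow> real) \<Rightarrow> (nat \<Rightarrow> real)" where
  "to_time T \<sigma> y = (\<lambda>i\<in>{1..T}. y (inv_into {1..T} \<sigma> i))"

definition first_KL :: "nat \<Rightarrow> (nat \<Rightarrow> (nat \<Rightarrow> real) \<Rightarrow> real measure)
                        \<Rightarrow> (nat \<Rightarrow> (nat \<Rightarrow> real) \<Rightarrow> real measure) \<Rightarrow> ennreal" where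
  "first_KL T kstar kth = KL (kstar 1 (trunc T 1 (\<lambda>_. 0))) (kth 1 (trunc T 1 (\<lambda>_. 0)))"

definition step_KL :: "nat \<Rightarrow> (nat \<Rightarrow> (nat \<Rightarrow> real) \<Rightarrow> real measure)
                        \<Rightarrow> (nat \<Rightarrow> (nat \<Rightarrow> real) \<Rightarrow> real measure) \<Rightarrow> nat \<Rightarrow> ennreal" where
  "step_KL T kstar kth s =
     (\<integral>\<^sup>+ y. KL (kstar s (trunc T s y)) (kth s (trunc T s y)) \<partial>(ar_law T kstar T))"

definition marg :: "(nat \<Rightarrow> real) measure \<Rightarrow> nat \<Rightarrow> real measure" where
  "marg Q t = distr Q borel (\<lambda>D. D t)"

definition obs_law :: "real \<Rightarrow> real measure \<Rightarrow> (real \<times> bool) measure" where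
  "obs_law x q = distr q Osp (psi x)"

definition Delta_comp ::
  "'w measure \<Rightarrow> (nat \<Rightarrow> 'w \<Rightarrow> real) \<Rightarrow> (nat \<Rightarrow> 'w \<Rightarrow> real) \<Rightarrow> nat
   \<Rightarrow> (nat \<Rightarrow> (nat \<Rightarrow> real \<times> real \<times> bool) \<Rightarrow> (nat \<Rightarrow> real) measure)
   \<Rightarrow> (nat \<Rightarrow> (nat \<Rightarrow> real \<times> real \<times> bool) \<Rightarrow> (nat \<Rightarrow> real) measure) \<Rightarrow> ennreal" where
  "Delta_comp M X D T Qs Qth =
     (\<Sum>t\<in>{1..T}. \<integral>\<^sup>+ \<omega>. KL (Qs t (hist X D t \<omega>)) (Qth t (hist X D t \<omega>)) \<partial>M)"

definition Delta_obs ::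
  "'w measure \<Rightarrow> (nat \<Rightarrow> 'w \<Rightarrow> real) \<Rightarrow> (nat \<Rightarrow> 'w \<Rightarrow> real) \<Rightarrow> nat
   \<Rightarrow> (nat \<Rightarrow> (nat \<Rightarrow> real \<times> real \<times> bool) \<Rightarrow> (nat \<Rightarrow> real) measure)
   \<Rightarrow> (nat \<Rightarrow> (nat \<Rightarrow> real \<times> real \<times> bool) \<Rightarrow> (nat \<Rightarrow> real) measure) \<Rightarrow> ennreal" where
  "Delta_obs M X D T Qs Qth =
     (\<Sum>t\<in>{1..T}. \<integral>\<^sup>+ \<omega>. KL (obs_law (X t \<omega>) (marg (Qs t (hist X D t \<omega>)) t))
                            (obs_law (X t \<omega>) (marg (Qth t (hist X D t \<omega>)) t)) \<partial>M)"

end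

theory Submission
  imports Defs
begin

text \<open>Everything rests on the variational formula that \<open>KL P Q\<close> is the supremum of
  \<open>\<integral>g dP - \<integral>(exp g - 1) dQ\<close> over bounded measurable \<open>g\<close>.  It gives data processing and the upper
  half of the chain rule, so the divergence of the whole completion is at most \<open>d(h)\<close> plus the later
  step divergences, hence at most \<open>(1 + c \<Sum>\<^sub>s\<^sub>\<ge>\<^sub>2 1/s) d(h) \<le> (1 + c ln T) d(h)\<close>.  On the real
  line countably many test functions suffice, so \<open>d\<close> is a measurable function of the history.  When
  \<open>X\<^sub>t = B\<close> the observation determines the demand, so there the divergence of the observations
  dominates \<open>d(h)\<close>; and \<open>X\<^sub>t = B\<close> has conditional probability at least \<open>\<eta>\<close> given the history.\<close>

subsection \<open>Variational formula and data processing\<close>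

text \<open>\<open>KL\<close> uses a Radon-Nikodym derivative chosen separately for each pair of
  measures, so its definition gives no measurability in the history. Most of the argument avoids the
  question: \<open>nn_integral\<close> is monotone for arbitrary integrands, and pointwise or a.e.
  bounds suffice. The exception is exploration, where the indicator of the event that the action is
  \<open>B\<close> is exchanged for its conditional probability; the function of the history
  standing beside it must be measurable, and that function is d(h). The dual form resolves this: for
  a fixed test function its value is built from two integrals, each measurable along a kernel, and a
  countable supremum keeps measurability. Since the autoregressive kernels are measurable in the
  prefix for each fixed history, joint measurability comes from the marginals of \<open>Qs\<close>
  and \<open>Qth\<close>, with which the first kernels are identified.\<close>

lemma space_prob_algebraD:
  assumes "P \<in> space (prob_algebra N)"
  shows "prob_space P" "sets P = sets N" "space P = space N" "measurable P L = measurable N L"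
  using assms by (auto simp: space_prob_algebra dest: sets_eq_imp_space_eq cong: measurable_cong_sets)

text \<open>The convex conjugate of \<open>u * ln u - u + 1\<close> on the nonnegative reals is
  \<open>exp g - 1\<close>. This form, unlike the one of Donsker and Varadhan with the logarithm of
  an integral, is affine in each measure.\<close>

definition dual_val :: "'a measure \<Rightarrow> 'a measure \<Rightarrow> ('a \<Rightarrow> real) \<Rightarrow> real" where
  "dual_val P Q g = (\<integral>x. g x \<partial>P) - ((\<integral>x. exp (g x) \<partial>Q) - 1)"

text \<open>This is \<open>1 + x \<le> exp x\<close> at \<open>x = g - ln f\<close>, multiplied by
  \<open>f\<close>; equality holds at \<open>g = ln f\<close>, which names the optimal test
  function.\<close>

lemma Fenchel_entropy:
  fixes f g :: real
  assumes "0 \<le> f"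
  shows "f * g - exp g + 1 \<le> f * ln f - f + 1"
proof (cases "f = 0")
  case False
  with assms have "f > 0" by simp
  then have "f * (1 + (g - ln f)) \<le> f * exp (g - ln f)"
    by (intro mult_left_mono) auto
  also have "\<dots> = exp g" using \<open>f > 0\<close> by (simp add: exp_diff)
  finally show ?thesis by (simp add: algebra_simps)
qed simp

text \<open>\<open>ennreal\<close> truncates negative values to 0, so the right side integrates the
  positive part of \<open>u\<close>.\<close>

lemma ennreal_integral_le_nn_integral:
  fixes u :: "'a \<Rightarrow> real"
  assumes "integrable M u"
  shows "ennreal (\<integral>x. u x \<partial>M) \<le> (\<integral>\<^sup>+x. ennreal (u x) \<partial>M)"
proof -
  have "ennreal (\<integral>x. u x \<partial>M) \<le> ennreal (\<integral>x. max 0 (u x) \<partial>M)"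
    using assms by (intro ennreal_leI integral_mono) auto
  also have "\<dots> = (\<integral>\<^sup>+x. ennreal (max 0 (u x)) \<partial>M)"
    using assms by (subst nn_integral_eq_integral) auto
  also have "\<dots> = (\<integral>\<^sup>+x. ennreal (u x) \<partial>M)"
    by (intro nn_integral_cong) (auto simp: max_def ennreal_neg)
  finally show ?thesis .
qed

lemma ennreal_add_le: "ennreal (a + b) \<le> ennreal a + ennreal b"
proof -
  have "ennreal (a + b) \<le> ennreal (max 0 a + max 0 b)" by (intro ennreal_leI) auto
  also have "\<dots> = ennreal a + ennreal b" by (subst ennreal_plus) (auto simp: max_def ennreal_neg)
  finally show ?thesis .
qed

lemma
  assumes "P \<in> space (prob_algebra N)" "Q \<in> space (prob_algebra N)" "absolutely_continuous Q P"
  defines "f \<equiv> \<lambda>x. enn2real (RN_deriv Q P x)"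
  shows RN_real_measurable: "f \<in> borel_measurable N"
    and RN_real_density: "P = density Q (\<lambda>x. ennreal (f x))"
proof -
  interpret Q: prob_space Q by (rule space_prob_algebraD(1)[OF assms(2)])
  interpret P: prob_space P by (rule space_prob_algebraD(1)[OF assms(1)])
  have s: "sets P = sets Q" using space_prob_algebraD(2)[OF assms(1)] space_prob_algebraD(2)[OF assms(2)] by simp
  have "f \<in> borel_measurable Q" unfolding f_def by (intro borel_measurable_enn2real borel_measurable_RN_deriv)
  then show "f \<in> borel_measurable N" by (simp add: space_prob_algebraD(4)[OF assms(2)])
  \<comment> \<open>\<open>enn2real\<close> sends infinity to 0, which is harmless because the
    derivative is finite almost everywhere.\<close>
  have "AE x in Q. RN_deriv Q P x \<noteq> \<infinity>"
    using assms(3) s by (intro Q.RN_deriv_finite) (auto intro: P.sigma_finite_measure_axioms)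
  then have "density Q (\<lambda>x. ennreal (f x)) = density Q (RN_deriv Q P)"
    by (intro density_cong) (auto simp: f_def less_top)
  also have "\<dots> = P" using assms(3) s by (rule Q.density_RN_deriv)
  finally show "P = density Q (\<lambda>x. ennreal (f x))" by simp
qed

lemma dual_val_density:
  assumes Q: "Q \<in> space (prob_algebra N)"
    and P: "prob_space (density Q (\<lambda>x. ennreal (f x)))"
    and f: "f \<in> borel_measurable N" "\<And>x. 0 \<le> f x"
    and g: "g \<in> borel_measurable N" "\<And>x. x \<in> space N \<Longrightarrow> \<bar>g x\<bar> \<le> b"
  shows "integrable Q (\<lambda>x. f x * g x - exp (g x) + 1)"
    and "dual_val (density Q (\<lambda>x. ennreal (f x))) Q g = (\<integral>x. f x * g x - exp (g x) + 1 \<partial>Q)"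
proof -
  interpret Q: prob_space Q by (rule space_prob_algebraD(1)[OF Q])
  interpret P: prob_space "density Q (\<lambda>x. ennreal (f x))" by fact
  note Q' = space_prob_algebraD[OF Q]
  have [measurable]: "f \<in> borel_measurable Q" "g \<in> borel_measurable Q"
    using f(1) g(1) by (simp_all add: Q')
  have "integrable (density Q (\<lambda>x. ennreal (f x))) g"
    using g by (intro P.integrable_const_bound[where B=b]) (auto simp: Q')
  then have i1: "integrable Q (\<lambda>x. f x * g x)"
    by (subst (asm) integrable_density) (auto simp: f)
  have i2: "integrable Q (\<lambda>x. exp (g x))"
    using g by (intro Q.integrable_const_bound[where B="exp b"] AE_I2) (auto simp: Q' dest!: abs_le_D1)
  show "integrable Q (\<lambda>x. f x * g x - exp (g x) + 1)" using i1 i2 by auto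
  have "(\<integral>x. g x \<partial>density Q (\<lambda>x. ennreal (f x))) = (\<integral>x. f x * g x \<partial>Q)"
    by (subst integral_density) (auto simp: f)
  then show "dual_val (density Q (\<lambda>x. ennreal (f x))) Q g = (\<integral>x. f x * g x - exp (g x) + 1 \<partial>Q)"
    using i1 i2 by (simp add: dual_val_def Q.prob_space)
qed

lemma dual_val_le_KL:
  assumes P: "P \<in> space (prob_algebra N)" and Q: "Q \<in> space (prob_algebra N)"
    and g: "g \<in> borel_measurable N" "\<And>x. x \<in> space N \<Longrightarrow> \<bar>g x\<bar> \<le> b"
  shows "ennreal (dual_val P Q g) \<le> KL P Q"
proof (cases "absolutely_continuous Q P")
  case True
  define f where "f = (\<lambda>x. enn2real (RN_deriv Q P x))"
  have f: "f \<in> borel_measurable N" "\<And>x. 0 \<le> f x" and Pd: "P = density Q (\<lambda>x. ennreal (f x))"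
    using RN_real_measurable[OF P Q True] RN_real_density[OF P Q True] by (auto simp: f_def)
  have "prob_space (density Q (\<lambda>x. ennreal (f x)))" using space_prob_algebraD(1)[OF P] Pd by simp
  note dv = dual_val_density[OF Q this f g]
  have "ennreal (dual_val P Q g) \<le> (\<integral>\<^sup>+x. ennreal (f x * g x - exp (g x) + 1) \<partial>Q)"
    using dv ennreal_integral_le_nn_integral[OF dv(1)] Pd by simp
  also have "\<dots> \<le> (\<integral>\<^sup>+x. ennreal (f x * ln (f x) - f x + 1) \<partial>Q)"
    using f(2) by (intro nn_integral_mono ennreal_leI Fenchel_entropy) auto
  also have "\<dots> = KL P Q" using True by (simp add: KL_def f_def Let_def)
  finally show ?thesis .
qed (simp add: KL_def)

text \<open>The optimal test function \<open>ln f\<close> may be unbounded, so it is clamped to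
  \<open>[-n, n]\<close>; at \<open>f = 0\<close> the value \<open>- n\<close> is set by hand,
  because HOL has \<open>ln 0 = 0\<close> where the limit is minus infinity. For
  \<open>f > 0\<close> the clamped \<open>g\<close> lies between 0 and \<open>ln f\<close>, so
  \<open>g * (f - exp g)\<close> is nonnegative. Nonnegativity of the integrand is what lets Fatou's
  lemma apply.\<close>

lemma clamp_ln_nonneg:
  fixes f :: real and n :: nat
  assumes "0 \<le> f"
  defines "g \<equiv> (if f = 0 then - real n else max (- real n) (min (real n) (ln f)))"
  shows "0 \<le> f * g - exp g + 1"
proof (cases "f = 0")
  case False
  with assms have f: "f > 0" by simp
  have "1 + (- g) \<le> exp (- g)" by (rule exp_ge_add_one_self)
  then have "exp g * (1 - g) \<le> exp g * exp (- g)" by (intro mult_left_mono) auto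
  then have 1: "exp g - 1 \<le> g * exp g" by (simp add: exp_minus algebra_simps)
  have "g * exp g \<le> g * f"
  proof (cases "ln f \<ge> 0")
    case True
    then have "0 \<le> g" "g \<le> ln f" using False by (auto simp: g_def)
    then have "exp g \<le> f" using f by (metis exp_le_cancel_iff exp_ln)
    then show ?thesis using \<open>0 \<le> g\<close> by (rule mult_left_mono)
  next
    case F: False
    then have "g \<le> 0" "ln f \<le> g" using False by (auto simp: g_def)
    then have "f \<le> exp g" using f by (metis exp_le_cancel_iff exp_ln)
    then show ?thesis using \<open>g \<le> 0\<close> by (rule mult_left_mono_neg)
  qed
  with 1 show ?thesis by (simp add: mult.commute)
qed (auto simp: g_def)

lemma clamp_ln_tendsto:
  fixes f :: real
  assumes "0 \<le> f"
  defines "g \<equiv> \<lambda>n::nat. (if f = 0 then - real n else max (- real n) (min (real n) (ln f)))"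
  shows "(\<lambda>n. f * g n - exp (g n) + 1) \<longlonglongrightarrow> f * ln f - f + 1"
proof (cases "f = 0")
  case True
  have "(\<lambda>n. 1 - exp (- real n)) \<longlonglongrightarrow> 1 - 0"
    by (intro tendsto_intros filterlim_compose[OF exp_at_bot] filterlim_uminus_at_bot_at_top filterlim_compose[OF filterlim_uminus_at_bot_at_top] filterlim_real_sequentially)
  then show ?thesis using True by (simp add: g_def)
next
  case False
  with assms have f: "f > 0" by simp
  obtain m where m: "\<bar>ln f\<bar> \<le> real m" using real_arch_simple by blast
  have "\<forall>\<^sub>F n in sequentially. g n = ln f"
    using eventually_ge_at_top[of m]
  proof eventually_elim
    case (elim n)
    then have "\<bar>ln f\<bar> \<le> real n" using m by linarith
    then show ?case using False by (auto simp: g_def)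
  qed
  then have "\<forall>\<^sub>F n in sequentially. f * ln f - f + 1 = f * g n - exp (g n) + 1"
    by eventually_elim (use f in simp)
  then show ?thesis by (rule tendsto_eventually[OF eventually_mono]) simp
qed

text \<open>Under absolute continuity, the dual values at the clamped logarithms of the density are
  integrals of nonnegative functions converging pointwise to the integrand of \<open>KL\<close>, and
  Fatou's lemma bounds the limit. Otherwise \<open>C\<close> is forced to be infinite.\<close>

lemma KL_le_dual:
  assumes P: "P \<in> space (prob_algebra N)" and Q: "Q \<in> space (prob_algebra N)"
    and C: "\<And>g b. g \<in> borel_measurable N \<Longrightarrow> (\<And>x. x \<in> space N \<Longrightarrow> \<bar>g x\<bar> \<le> b) \<Longrightarrow> ennreal (dual_val P Q g) \<le> C"
  shows "KL P Q \<le> C"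
proof -
  interpret P: prob_space P by (rule space_prob_algebraD(1)[OF P])
  interpret Q: prob_space Q by (rule space_prob_algebraD(1)[OF Q])
  note P' = space_prob_algebraD[OF P] and Q' = space_prob_algebraD[OF Q]
  show ?thesis
  proof (cases "absolutely_continuous Q P")
    case True
    define f where "f = (\<lambda>x. enn2real (RN_deriv Q P x))"
    have f: "f \<in> borel_measurable N" "\<And>x. 0 \<le> f x" and Pd: "P = density Q (\<lambda>x. ennreal (f x))"
      using RN_real_measurable[OF P Q True] RN_real_density[OF P Q True] by (auto simp: f_def)
    define g where "g = (\<lambda>n x. if f x = 0 then - real n else max (- real n) (min (real n) (ln (f x))))"
    define u where "u = (\<lambda>n x. f x * g n x - exp (g n x) + 1)"
    have [measurable]: "f \<in> borel_measurable Q" using f by (simp add: Q')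
    have gN: "g n \<in> borel_measurable N" for n using f(1) unfolding g_def by measurable
    have [measurable]: "g n \<in> borel_measurable Q" for n using gN by (simp add: Q')
    have u_meas: "u n \<in> borel_measurable Q" for n unfolding u_def by measurable
    have gb: "\<bar>g n x\<bar> \<le> real n" for n x by (auto simp: g_def)
    have pd: "prob_space (density Q (\<lambda>x. ennreal (f x)))" using P'(1) Pd by simp
    have int_u: "(\<integral>\<^sup>+x. ennreal (u n x) \<partial>Q) \<le> C" for n
    proof -
      note dv = dual_val_density[OF Q pd f gN gb, of n]
      have "(\<integral>\<^sup>+x. ennreal (u n x) \<partial>Q) = ennreal (dual_val P Q (g n))"
        using dv clamp_ln_nonneg[OF f(2)] Pd unfolding u_def g_def
        by (subst nn_integral_eq_integral) auto
      also have "\<dots> \<le> C" by (rule C[OF gN gb])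
      finally show ?thesis .
    qed
    have "KL P Q = (\<integral>\<^sup>+x. ennreal (f x * ln (f x) - f x + 1) \<partial>Q)"
      using True by (simp add: KL_def f_def Let_def)
    also have "\<dots> = (\<integral>\<^sup>+x. liminf (\<lambda>n. ennreal (u n x)) \<partial>Q)"
      using clamp_ln_tendsto[OF f(2)] unfolding u_def g_def
      by (intro nn_integral_cong lim_imp_Liminf[symmetric] tendsto_ennrealI) auto
    also have "\<dots> \<le> liminf (\<lambda>n. \<integral>\<^sup>+x. ennreal (u n x) \<partial>Q)"
      by (intro nn_integral_liminf) (use u_meas in measurable)
    also have "\<dots> \<le> C"
      using int_u by (intro Liminf_le) auto
    finally show ?thesis .
  next
    case False
    then obtain A where A: "A \<in> null_sets Q" "A \<notin> null_sets P" by (auto simp: absolutely_continuous_def)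
    then have AN: "A \<in> sets N" "A \<in> sets P" "A \<in> sets Q" by (auto simp: P' Q')
    with A have pos: "0 < measure P A"
      by (auto simp: null_sets_def P.emeasure_eq_measure zero_less_measure_iff)
    \<comment> \<open>Test with \<open>n\<close> times the indicator of a \<open>Q\<close>-null set
      that \<open>P\<close> charges: the exponential term does not see the set, while the linear
      term grows without bound.\<close>
    have "ennreal (real n * measure P A) \<le> C" for n
    proof -
      have "(\<integral>x. exp (real n * indicator A x) \<partial>Q) = (\<integral>x. 1 \<partial>Q)"
      proof (rule integral_cong_AE)
        show "AE x in Q. exp (real n * indicator A x) = 1"
          using AE_not_in[OF A(1)] by eventually_elim simp
      qed (use AN(3) in measurable)
      then have "dual_val P Q (\<lambda>x. real n * indicator A x) = real n * measure P A"
        using AN(2) by (simp add: dual_val_def Q.prob_space Int_absorb2 sets.sets_into_space)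
      moreover have "ennreal (dual_val P Q (\<lambda>x. real n * indicator A x)) \<le> C"
        using AN(1) by (intro C[of _ "real n"]) (auto simp: indicator_def)
      ultimately show ?thesis by simp
    qed
    then have C_ge: "of_nat n * ennreal (measure P A) \<le> C" for n
      by (simp add: ennreal_mult ennreal_of_nat_eq_real_of_nat)
    have "C = \<top>"
    proof (rule ccontr)
      assume "C \<noteq> \<top>"
      then obtain c where c: "C = ennreal c" "0 \<le> c" by (cases C) auto
      obtain n where "c < real n * measure P A" using reals_Archimedean3[OF pos] by blast
      then have "ennreal c < ennreal (real n * measure P A)"
        using c by (intro ennreal_lessI) auto
      then show False using C_ge[of n] c pos by (simp add: ennreal_mult ennreal_of_nat_eq_real_of_nat)
    qed
    then show ?thesis by simp
  qed
qed

text \<open>Data processing: a test function on the target, composed with \<open>f\<close>, is a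
  test function on the source with the same dual value.\<close>

lemma KL_distr_le:
  assumes P: "P \<in> space (prob_algebra N)" and Q: "Q \<in> space (prob_algebra N)"
    and f: "f \<in> measurable N L"
  shows "KL (distr P L f) (distr Q L f) \<le> KL P Q"
proof (rule KL_le_dual)
  note P' = space_prob_algebraD[OF P] and Q' = space_prob_algebraD[OF Q]
  have fPQ: "f \<in> measurable P L" "f \<in> measurable Q L" using f by (auto simp: P' Q')
  show "distr P L f \<in> space (prob_algebra L)" "distr Q L f \<in> space (prob_algebra L)"
    using fPQ P' Q' by (auto simp: space_prob_algebra intro!: prob_space.prob_space_distr)
  fix g :: "_ \<Rightarrow> real" and b assume g: "g \<in> borel_measurable L" "\<And>x. x \<in> space L \<Longrightarrow> \<bar>g x\<bar> \<le> b"
  have "dual_val (distr P L f) (distr Q L f) g = dual_val P Q (\<lambda>x. g (f x))"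
    using fPQ g by (simp add: dual_val_def integral_distr)
  also have "ennreal \<dots> \<le> KL P Q"
    using g f measurable_space[OF f] by (intro dual_val_le_KL[OF P Q, where b=b]) auto
  finally show "ennreal (dual_val (distr P L f) (distr Q L f) g) \<le> KL P Q" .
qed

subsection \<open>Chain rule\<close>

lemma bind_in_space_prob_algebra:
  assumes "P \<in> space (prob_algebra N)" "K \<in> measurable N (prob_algebra R)"
  shows "P \<bind> K \<in> space (prob_algebra R)"
  using prob_space_bind'[OF assms] sets_bind'[OF assms] by (simp add: space_prob_algebra)

text \<open>Only the upper bound in the chain rule is needed.  The divergences of the kernels enter through
  the lower integral \<^const>\<open>nn_integral\<close>, so their measurability is irrelevant: for each fixed test
  function \<open>g\<close>, normalising by the partition function \<open>Z y\<close> gives a measurable minorant of them.\<close>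

lemma KL_bind_le:
  assumes P: "P \<in> space (prob_algebra N)" and Q: "Q \<in> space (prob_algebra N)"
    and J: "J \<in> measurable N (prob_algebra R)" and K: "K \<in> measurable N (prob_algebra R)"
  shows "KL (P \<bind> J) (Q \<bind> K) \<le> KL P Q + (\<integral>\<^sup>+y. KL (J y) (K y) \<partial>P)"
proof (rule KL_le_dual[OF bind_in_space_prob_algebra[OF P J] bind_in_space_prob_algebra[OF Q K]])
  fix g :: "_ \<Rightarrow> real" and b assume g: "g \<in> borel_measurable R" "\<And>x. x \<in> space R \<Longrightarrow> \<bar>g x\<bar> \<le> b"
  interpret P: prob_space P by (rule space_prob_algebraD(1)[OF P])
  interpret Q: prob_space Q by (rule space_prob_algebraD(1)[OF Q])
  note P' = space_prob_algebraD[OF P] and Q' = space_prob_algebraD[OF Q]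
  have J': "J \<in> measurable N (subprob_algebra R)" and K': "K \<in> measurable N (subprob_algebra R)"
    using J K by (auto intro: measurable_prob_algebraD)
  have Jy: "J y \<in> space (prob_algebra R)" and Ky: "K y \<in> space (prob_algebra R)" if "y \<in> space N" for y
    using measurable_space[OF J that] measurable_space[OF K that] .
  define Z where "Z = (\<lambda>y. \<integral>x. exp (g x) \<partial>K y)"
  define a where "a = (\<lambda>y. \<integral>x. g x \<partial>J y)"
  have Zm: "Z \<in> borel_measurable N"
    unfolding Z_def using g(1) by (intro measurable_compose[OF K' integral_measurable_subprob_algebra]) auto
  have am: "a \<in> borel_measurable N"
    unfolding a_def using g(1) by (intro measurable_compose[OF J' integral_measurable_subprob_algebra]) auto
  have Zb: "exp (- b) \<le> Z y" "Z y \<le> exp b" "integrable (K y) (\<lambda>x. exp (g x))" if y: "y \<in> space N" for y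
  proof -
    interpret Ky: prob_space "K y" using space_prob_algebraD(1)[OF Ky[OF y]] .
    note Ky' = space_prob_algebraD[OF Ky[OF y]]
    have gb: "- b \<le> g x" "g x \<le> b" if "x \<in> space R" for x using g(2)[OF that] by auto
    have gm: "(\<lambda>x. exp (g x)) \<in> borel_measurable (K y)" using g(1) by (simp add: Ky')
    show i: "integrable (K y) (\<lambda>x. exp (g x))"
      using gb gm by (intro Ky.integrable_const_bound[where B="exp b"]) (auto simp: Ky' intro!: AE_I2)
    show "exp (- b) \<le> Z y" unfolding Z_def
      using i gb by (intro Ky.integral_ge_const AE_I2) (auto simp: Ky')
    show "Z y \<le> exp b" unfolding Z_def
      using i gb by (intro Ky.integral_le_const AE_I2) (auto simp: Ky')
  qed
  have Zpos: "0 < Z y" if "y \<in> space N" for y using Zb(1)[OF that] by (rule less_le_trans[OF exp_gt_zero])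
  have Lb: "\<bar>ln (Z y)\<bar> \<le> b" if "y \<in> space N" for y
  proof -
    have "ln (exp (- b)) \<le> ln (Z y)" "ln (Z y) \<le> ln (exp b)"
      using Zb[OF that] Zpos[OF that] by (intro ln_mono; simp)+
    then show ?thesis by simp
  qed
  have ab: "\<bar>a y\<bar> \<le> b" and gi: "integrable (J y) g" if y: "y \<in> space N" for y
  proof -
    interpret Jy: prob_space "J y" using space_prob_algebraD(1)[OF Jy[OF y]] .
    note Jy' = space_prob_algebraD[OF Jy[OF y]]
    have gb: "- b \<le> g x" "g x \<le> b" if "x \<in> space R" for x using g(2)[OF that] by auto
    show i: "integrable (J y) g"
      using g by (intro Jy.integrable_const_bound[where B="b"]) (auto simp: Jy' intro!: AE_I2)
    have "- b \<le> a y" unfolding a_def using i gb by (intro Jy.integral_ge_const AE_I2) (auto simp: Jy')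
    moreover have "a y \<le> b" unfolding a_def using i gb by (intro Jy.integral_le_const AE_I2) (auto simp: Jy')
    ultimately show "\<bar>a y\<bar> \<le> b" by auto
  qed
  have ai: "integrable P a" using am ab by (intro P.integrable_const_bound[where B=b]) (auto simp: P' intro!: AE_I2)
  have Lm: "(\<lambda>y. ln (Z y)) \<in> borel_measurable N" using Zm by measurable
  have Li: "integrable P (\<lambda>y. ln (Z y))"
    using Lm Lb by (intro P.integrable_const_bound[where B=b]) (auto simp: P' intro!: AE_I2)
  \<comment> \<open>Shifting \<open>g\<close> by \<open>ln (Z y)\<close> makes its exponential
    integrate to 1 under \<open>K y\<close>, so the second part of \<open>dual_val\<close>
    vanishes.\<close>
  have inner: "ennreal (a y - ln (Z y)) \<le> KL (J y) (K y)" if y: "y \<in> space N" for y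
  proof -
    interpret Jy: prob_space "J y" using space_prob_algebraD(1)[OF Jy[OF y]] .
    have "dual_val (J y) (K y) (\<lambda>x. g x - ln (Z y)) = a y - ln (Z y)"
      using gi[OF y] Zb(3)[OF y] Zpos[OF y]
      by (simp add: dual_val_def a_def Jy.prob_space exp_diff Z_def)
    moreover have "ennreal (dual_val (J y) (K y) (\<lambda>x. g x - ln (Z y))) \<le> KL (J y) (K y)"
    proof (rule dual_val_le_KL[OF Jy[OF y] Ky[OF y], where b="2 * b"])
      show "\<bar>g x - ln (Z y)\<bar> \<le> 2 * b" if "x \<in> space R" for x
        using g(2)[OF that] Lb[OF y] by linarith
    qed (use g in measurable)
    ultimately show ?thesis by simp
  qed
  have eJ: "(\<integral>x. g x \<partial>(P \<bind> J)) = (\<integral>y. a y \<partial>P)"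
    unfolding a_def
  proof (rule integral_bind[where K=R and B'=1 and B=b])
    show "J \<in> measurable P (subprob_algebra R)" using J' by (simp add: P')
    show "AE x in P. emeasure (J x) (space (J x)) \<le> ennreal 1"
      using space_prob_algebraD(1)[OF Jy] by (auto simp: P' prob_space.emeasure_space_1 intro!: AE_I2)
  qed (use g P.finite_measure_axioms in auto)
  have eK: "(\<integral>x. exp (g x) \<partial>(Q \<bind> K)) = (\<integral>y. Z y \<partial>Q)"
    unfolding Z_def
  proof (rule integral_bind[where K=R and B'=1 and B="exp b"])
    show "K \<in> measurable Q (subprob_algebra R)" using K' by (simp add: Q')
    show "AE x in Q. emeasure (K x) (space (K x)) \<le> ennreal 1"
      using space_prob_algebraD(1)[OF Ky] by (auto simp: Q' prob_space.emeasure_space_1 intro!: AE_I2)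
  qed (use g Q.finite_measure_axioms in \<open>auto dest: abs_le_D1\<close>)
  \<comment> \<open>\<open>ln Z\<close> serves as the test function for the base laws
    \<open>P\<close> and \<open>Q\<close>: adding and subtracting its \<open>P\<close>-integral
    splits the dual value of \<open>g\<close> into a part for the base and a part for the
    kernels.\<close>
  have "(\<integral>y. exp (ln (Z y)) \<partial>Q) = (\<integral>y. Z y \<partial>Q)"
    using Zpos by (intro Bochner_Integration.integral_cong) (auto simp: Q')
  then have "dual_val (P \<bind> J) (Q \<bind> K) g = dual_val P Q (\<lambda>y. ln (Z y)) + (\<integral>y. a y - ln (Z y) \<partial>P)"
    using ai Li by (simp add: dual_val_def eJ eK)
  also have "ennreal \<dots> \<le> ennreal (dual_val P Q (\<lambda>y. ln (Z y))) + ennreal (\<integral>y. a y - ln (Z y) \<partial>P)"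
    by (rule ennreal_add_le)
  also have "\<dots> \<le> KL P Q + (\<integral>\<^sup>+y. ennreal (a y - ln (Z y)) \<partial>P)"
    using Lm Lb ai Li by (intro add_mono dual_val_le_KL[OF P Q] ennreal_integral_le_nn_integral) auto
  also have "\<dots> \<le> KL P Q + (\<integral>\<^sup>+y. KL (J y) (K y) \<partial>P)"
    using inner by (intro add_left_mono nn_integral_mono) (auto simp: P')
  finally show "ennreal (dual_val (P \<bind> J) (Q \<bind> K) g) \<le> KL P Q + (\<integral>\<^sup>+y. KL (J y) (K y) \<partial>P)" .
qed

text \<open>\<open>F\<close> may be nonmeasurable: every simple minorant of \<open>F\<close> pulls
  back to a minorant of \<open>F \<circ> f\<close>, but not conversely, hence an inequality only. It
  is the direction wanted in \<open>KL_ar_law_le\<close>.\<close>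

lemma nn_integral_distr_le:
  assumes f: "f \<in> measurable M N"
  shows "(\<integral>\<^sup>+y. F y \<partial>distr M N f) \<le> (\<integral>\<^sup>+x. F (f x) \<partial>M)"
  unfolding nn_integral_def[of "distr M N f"]
proof (rule SUP_least, safe)
  fix g assume g: "simple_function (distr M N f) g" "g \<le> F"
  have gm: "g \<in> borel_measurable N" using borel_measurable_simple_function[OF g(1)] by simp
  have "integral\<^sup>S (distr M N f) g = (\<integral>\<^sup>+y. g y \<partial>distr M N f)" using g by (simp add: nn_integral_eq_simple_integral)
  also have "\<dots> = (\<integral>\<^sup>+x. g (f x) \<partial>M)" using gm f by (simp add: nn_integral_distr)
  also have "\<dots> \<le> (\<integral>\<^sup>+x. F (f x) \<partial>M)" using g(2) by (intro nn_integral_mono) (simp add: le_fun_def)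
  finally show "integral\<^sup>S (distr M N f) g \<le> (\<integral>\<^sup>+x. F (f x) \<partial>M)" .
qed

subsection \<open>A countable family of test functions on the real line\<close>

text \<open>Rational combinations of rational half-lines: a countable family of test functions on the
  real line that is dense in \<open>L\<^sup>1\<close> of every finite Borel measure.\<close>

definition rat_step :: "(rat \<times> rat) list \<Rightarrow> real \<Rightarrow> real" where
  "rat_step l x = (\<Sum>(r, a)\<leftarrow>l. of_rat r * indicator {..of_rat a} x)"

lemma borel_measurable_rat_step [measurable]: "rat_step l \<in> borel_measurable borel"
  unfolding rat_step_def[abs_def] by (induction l) (auto simp: case_prod_beta)

lemma rat_step_append: "rat_step (l @ l') x = rat_step l x + rat_step l' x"
  by (simp add: rat_step_def)

lemma rat_step_bounded: "\<exists>b. \<forall>x. \<bar>rat_step l x\<bar> \<le> b"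
proof (induction l)
  case (Cons p l)
  then obtain b where b: "\<And>x. \<bar>rat_step l x\<bar> \<le> b" by blast
  obtain r a where p: "p = (r, a)" by force
  have "\<bar>rat_step (p # l) x\<bar> \<le> \<bar>of_rat r\<bar> + b" for x
  proof -
    have "\<bar>of_rat r * indicat_real {..of_rat a} x\<bar> \<le> \<bar>of_rat r\<bar>" by (simp add: indicator_def)
    moreover have "rat_step (p # l) x = of_rat r * indicator {..of_rat a} x + rat_step l x"
      by (simp add: rat_step_def p)
    ultimately show ?thesis using b[of x] by linarith
  qed
  then show ?case by blast
qed (auto simp: rat_step_def)

lemma sets_borel_rat_atMost:
  "sets (borel :: real measure) = sigma_sets UNIV (range (\<lambda>a. {..of_rat a :: real}))"
proof -
  have "borel = sigma UNIV (range (\<lambda>a::rat. {..of_rat a :: real}))"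
  proof (rule borel_eq_sigmaI1[OF borel_eq_atMost])
    fix X assume "X \<in> range (\<lambda>a::real. {..a})"
    then obtain a where X: "X = {..a}" by blast
    have "X = (\<Inter>q\<in>{q. a < of_rat q}. {..of_rat q})"
    proof (intro equalityI subsetI)
      fix x :: real assume x: "x \<in> (\<Inter>q\<in>{q. a < of_rat q}. {..of_rat q})"
      show "x \<in> X"
      proof (rule ccontr)
        assume "x \<notin> X"
        then obtain q where "a < of_rat q" "of_rat q < x" using of_rat_dense[of a x] X by auto
        then show False using x by force
      qed
    qed (auto simp: X)
    moreover obtain q where "a < of_rat q" by (metis gt_ex of_rat_dense)
    moreover have "{..of_rat q :: real} \<in> sets (sigma UNIV (range (\<lambda>a::rat. {..of_rat a :: real})))" for q
      by auto
    ultimately show "X \<in> sets (sigma UNIV (range (\<lambda>a::rat. {..of_rat a :: real})))"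
      by (auto simp del: sets_measure_of intro!: sets.countable_INT')
  qed auto
  then show ?thesis by (metis sets_measure_of subset_UNIV Pow_UNIV)
qed

section \<open>Density of the rational step functions in L1\<close>

definition L1_approx :: "real measure \<Rightarrow> (real \<Rightarrow> real) \<Rightarrow> bool" where
  "L1_approx M g \<longleftrightarrow> integrable M g \<and> (\<forall>e>0. \<exists>l. (\<integral>x. \<bar>g x - rat_step l x\<bar> \<partial>M) < e)"

context
  fixes M :: "real measure"
  assumes fin: "finite_measure M" and sets_M: "sets M = sets borel"
begin

interpretation finite_measure M by (rule fin)

lemma borel_measurable_M: "borel_measurable M = borel_measurable borel" "space M = UNIV"
  using sets_M sets_eq_imp_space_eq[OF sets_M] by (auto cong: measurable_cong_sets)

lemma integrable_rat_step: "integrable M (rat_step l)"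
proof -
  obtain b where "\<And>x. \<bar>rat_step l x\<bar> \<le> b" using rat_step_bounded by blast
  then show ?thesis by (intro integrable_const_bound[where B=b]) (auto simp: borel_measurable_M)
qed

text \<open>The class is closed in the L1 norm; \<open>e\<close> is halved between the two
  approximations.\<close>

lemma L1_approx_lim:
  assumes g: "integrable M g" and "\<And>e. e > 0 \<Longrightarrow> \<exists>h. L1_approx M h \<and> (\<integral>x. \<bar>g x - h x\<bar> \<partial>M) < e"
  shows "L1_approx M g"
  unfolding L1_approx_def
proof (intro conjI allI impI g)
  fix e :: real assume "e > 0"
  then obtain h where h: "L1_approx M h" "(\<integral>x. \<bar>g x - h x\<bar> \<partial>M) < e / 2" using assms(2)[of "e/2"] by auto
  then obtain l where l: "(\<integral>x. \<bar>h x - rat_step l x\<bar> \<partial>M) < e / 2"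
    using \<open>e > 0\<close> unfolding L1_approx_def by (meson half_gt_zero)
  have hi: "integrable M h" using h by (simp add: L1_approx_def)
  have "(\<integral>x. \<bar>g x - rat_step l x\<bar> \<partial>M) \<le> (\<integral>x. \<bar>g x - h x\<bar> + \<bar>h x - rat_step l x\<bar> \<partial>M)"
    using g hi integrable_rat_step by (intro integral_mono) auto
  also have "\<dots> = (\<integral>x. \<bar>g x - h x\<bar> \<partial>M) + (\<integral>x. \<bar>h x - rat_step l x\<bar> \<partial>M)"
    using g hi integrable_rat_step by (intro Bochner_Integration.integral_add) auto
  also have "\<dots> < e" using h l by linarith
  finally show "\<exists>l. (\<integral>x. \<bar>g x - rat_step l x\<bar> \<partial>M) < e" by blast
qed

lemma L1_approx_LIMSEQ:
  assumes s: "\<And>i. L1_approx M (s i)" and g: "g \<in> borel_measurable borel"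
    and lim: "\<And>x. (\<lambda>i. s i x) \<longlonglongrightarrow> g x"
    and w: "integrable M w" "\<And>i x. \<bar>s i x\<bar> \<le> w x"
  shows "L1_approx M g"
proof (rule L1_approx_lim)
  have si: "integrable M (s i)" for i using s by (simp add: L1_approx_def)
  have gw: "\<bar>g x\<bar> \<le> w x" for x
    using LIMSEQ_le_const2[OF tendsto_rabs[OF lim[of x]]] w(2) by blast
  show gi: "integrable M g"
    using gw by (intro Bochner_Integration.integrable_bound[OF w(1)]) (auto simp: borel_measurable_M g intro!: AE_I2 order_trans[OF _ abs_ge_self])
  have "(\<lambda>i. \<integral>x. \<bar>g x - s i x\<bar> \<partial>M) \<longlonglongrightarrow> (\<integral>x. 0 \<partial>M)"
  proof (rule integral_dominated_convergence[where w="\<lambda>x. 2 * w x"])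
    show "AE x in M. (\<lambda>i. \<bar>g x - s i x\<bar>) \<longlonglongrightarrow> 0"
      using lim by (intro AE_I2) (auto intro!: tendsto_eq_intros)
    show "AE x in M. norm \<bar>g x - s i x\<bar> \<le> 2 * w x" for i
    proof (rule AE_I2)
      fix x show "norm \<bar>g x - s i x\<bar> \<le> 2 * w x" using gw[of x] w(2)[of i x] by simp
    qed
  qed (use w si gi in auto)
  then have lim0: "(\<lambda>i. \<integral>x. \<bar>g x - s i x\<bar> \<partial>M) \<longlonglongrightarrow> 0" by simp
  fix e :: real assume "e > 0"
  then have "\<forall>\<^sub>F i in sequentially. (\<integral>x. \<bar>g x - s i x\<bar> \<partial>M) < e"
    using order_tendstoD(2)[OF lim0] by blast
  then obtain i where "(\<integral>x. \<bar>g x - s i x\<bar> \<partial>M) < e" by (auto simp: eventually_sequentially)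
  then show "\<exists>h. L1_approx M h \<and> (\<integral>x. \<bar>g x - h x\<bar> \<partial>M) < e" using s by blast
qed

lemma L1_approx_rat_step: "L1_approx M (rat_step l)"
  unfolding L1_approx_def using integrable_rat_step by (auto intro!: exI[of _ l])

lemma L1_approx_add:
  assumes "L1_approx M g" "L1_approx M h"
  shows "L1_approx M (\<lambda>x. g x + h x)"
  unfolding L1_approx_def
proof (intro conjI allI impI)
  have gi: "integrable M g" "integrable M h" using assms by (auto simp: L1_approx_def)
  then show "integrable M (\<lambda>x. g x + h x)" by simp
  fix e :: real assume "e > 0"
  then obtain l l' where l: "(\<integral>x. \<bar>g x - rat_step l x\<bar> \<partial>M) < e / 2" "(\<integral>x. \<bar>h x - rat_step l' x\<bar> \<partial>M) < e / 2"
    using assms unfolding L1_approx_def by (meson half_gt_zero)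
  have "(\<integral>x. \<bar>g x + h x - rat_step (l @ l') x\<bar> \<partial>M) \<le> (\<integral>x. \<bar>g x - rat_step l x\<bar> + \<bar>h x - rat_step l' x\<bar> \<partial>M)"
    using gi integrable_rat_step by (intro integral_mono) (auto simp: rat_step_append)
  also have "\<dots> = (\<integral>x. \<bar>g x - rat_step l x\<bar> \<partial>M) + (\<integral>x. \<bar>h x - rat_step l' x\<bar> \<partial>M)"
    using gi integrable_rat_step by (intro Bochner_Integration.integral_add) auto
  also have "\<dots> < e" using l by linarith
  finally show "\<exists>l. (\<integral>x. \<bar>g x + h x - rat_step l x\<bar> \<partial>M) < e" by blast
qed

lemma L1_approx_cmult_rat:
  assumes "L1_approx M g"
  shows "L1_approx M (\<lambda>x. of_rat r * g x)"
  unfolding L1_approx_def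
proof (intro conjI allI impI)
  have gi: "integrable M g" using assms by (auto simp: L1_approx_def)
  then show "integrable M (\<lambda>x. of_rat r * g x)" by simp
  fix e :: real assume "e > 0"
  \<comment> \<open>The \<open>+ 1\<close> keeps the divisor positive when
    \<open>r = 0\<close>.\<close>
  then have "e / (\<bar>of_rat r\<bar> + 1) > 0" by (auto intro!: divide_pos_pos add_nonneg_pos)
  then obtain l where l: "(\<integral>x. \<bar>g x - rat_step l x\<bar> \<partial>M) < e / (\<bar>of_rat r\<bar> + 1)"
    using assms unfolding L1_approx_def by meson
  have "rat_step (map (\<lambda>(s, a). (r * s, a)) l) x = of_rat r * rat_step l x" for x
    by (induction l) (auto simp: rat_step_def of_rat_mult algebra_simps)
  then have "(\<integral>x. \<bar>of_rat r * g x - rat_step (map (\<lambda>(s, a). (r * s, a)) l) x\<bar> \<partial>M) = (\<integral>x. \<bar>of_rat r\<bar> * \<bar>g x - rat_step l x\<bar> \<partial>M)"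
    by (simp add: right_diff_distrib[symmetric] abs_mult)
  also have "\<dots> = \<bar>of_rat r\<bar> * (\<integral>x. \<bar>g x - rat_step l x\<bar> \<partial>M)" by simp
  also have "\<dots> \<le> (\<bar>of_rat r\<bar> + 1) * (\<integral>x. \<bar>g x - rat_step l x\<bar> \<partial>M)"
    by (intro mult_right_mono) auto
  also have "\<dots> < e" using l by (simp add: pos_less_divide_eq add_nonneg_pos mult.commute)
  finally show "\<exists>l. (\<integral>x. \<bar>of_rat r * g x - rat_step l x\<bar> \<partial>M) < e" by blast
qed

text \<open>Lists carry rational coefficients only, so a real factor is approached by a rational
  one; the error is the distance of the factors times the L1 norm of \<open>g\<close>.\<close>

lemma L1_approx_cmult:
  assumes "L1_approx M g"
  shows "L1_approx M (\<lambda>x. c * g x)"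
proof (rule L1_approx_lim)
  have gi: "integrable M g" using assms by (auto simp: L1_approx_def)
  then show "integrable M (\<lambda>x. c * g x)" by simp
  fix e :: real assume e: "e > 0"
  define I where "I = (\<integral>x. \<bar>g x\<bar> \<partial>M)"
  have I: "0 \<le> I" by (simp add: I_def)
  then have "0 < e / (I + 1)" using e by simp
  then obtain r where r: "c < of_rat r" "of_rat r < c + e / (I + 1)"
    using of_rat_dense[of c "c + e / (I + 1)"] by auto
  have "(\<integral>x. \<bar>c * g x - of_rat r * g x\<bar> \<partial>M) = \<bar>c - of_rat r\<bar> * I"
    by (simp add: left_diff_distrib[symmetric] abs_mult I_def)
  also have "\<dots> \<le> e / (I + 1) * I" using r I by (intro mult_right_mono) auto
  also have "\<dots> < e" using I e by (simp add: field_simps)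
  finally show "\<exists>h. L1_approx M h \<and> (\<integral>x. \<bar>c * g x - h x\<bar> \<partial>M) < e"
    using L1_approx_cmult_rat[OF assms] by blast
qed

lemma L1_approx_sum: "(\<And>i. i \<in> A \<Longrightarrow> L1_approx M (g i)) \<Longrightarrow> finite A \<Longrightarrow> L1_approx M (\<lambda>x. \<Sum>i\<in>A. g i x)"
proof (induction A rule: infinite_finite_induct)
  case empty
  then show ?case using L1_approx_rat_step[of "[]"] by (simp add: rat_step_def[abs_def])
qed (auto intro: L1_approx_add)

text \<open>Dynkin's argument: rational half-lines are stable under intersection and generate the
  Borel sets, and the class passes to complements and, by dominated convergence, to disjoint
  unions.\<close>

lemma L1_approx_indicator:
  assumes "A \<in> sets borel"
  shows "L1_approx M (indicator A)"
proof -
  have half: "L1_approx M (indicator {..of_rat a})" for a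
    using L1_approx_rat_step[of "[(1, a)]"] by (simp add: rat_step_def[abs_def])
  \<comment> \<open>The constant 1, needed for complements, is the limit of the indicators of
    \<open>{..i}\<close>; finiteness of \<open>M\<close> makes it a dominating function as
    well.\<close>
  have one: "L1_approx M (\<lambda>x. 1)"
  proof (rule L1_approx_LIMSEQ)
    show "L1_approx M (indicator {..of_rat (of_nat i)})" for i by (rule half)
    show "(\<lambda>i. indicat_real {..of_rat (of_nat i)} x) \<longlonglongrightarrow> 1" for x :: real
    proof -
      obtain m where m: "x \<le> real m" using real_arch_simple by blast
      have "\<forall>\<^sub>F i in sequentially. indicat_real {..of_rat (of_nat i)} x = 1"
        using eventually_ge_at_top[of m] by eventually_elim (use m in auto)
      then show ?thesis by (rule tendsto_eventually)
    qed
  qed (auto intro: integrable_const simp: indicator_def)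
  have "Int_stable (range (\<lambda>a. {..of_rat a :: real}))"
  proof (rule Int_stableI)
    fix X Y assume "X \<in> range (\<lambda>a. {..of_rat a :: real})" "Y \<in> range (\<lambda>a. {..of_rat a :: real})"
    then obtain a b where "X = {..of_rat a}" "Y = {..of_rat b}" by auto
    then have "X \<inter> Y = {..of_rat (min a b)}" by (auto simp: min_def of_rat_less_eq)
    then show "X \<inter> Y \<in> range (\<lambda>a. {..of_rat a :: real})" by blast
  qed
  note * = this subset_UNIV[of "range (\<lambda>a. {..of_rat a :: real})", folded Pow_UNIV]
    assms[unfolded sets_borel_rat_atMost]
  from * show ?thesis
  proof (induction rule: sigma_sets_induct_disjoint)
    case (basic A)
    then show ?case using half by auto
  next
    case empty
    then show ?case using L1_approx_rat_step[of "[]"] by (simp add: rat_step_def[abs_def])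
  next
    case (compl A)
    have "L1_approx M (\<lambda>x. 1 + (- 1) * indicator A x)"
      by (intro L1_approx_add one L1_approx_cmult compl)
    moreover have "(\<lambda>x. 1 + (- 1) * indicator A x) = indicat_real (UNIV - A)" by (auto simp: indicator_def)
    ultimately show ?case by simp
  next
    case (union A)
    then have A: "range A \<subseteq> sets borel" unfolding sets_borel_rat_atMost by blast
    \<comment> \<open>Disjointness keeps the partial sums bounded by 1, the dominating function
      below.\<close>
    have eq: "(\<Sum>i<n. indicat_real (A i) x) = indicator (\<Union>i<n. A i) x" for n x
      using union(1) by (subst indicator_UN_disjoint) (auto simp: disjoint_family_on_def)
    show ?case
    proof (rule L1_approx_LIMSEQ)
      show "L1_approx M (\<lambda>x. \<Sum>i<n. indicator (A i) x)" for n by (intro L1_approx_sum union) auto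
      show "(\<lambda>n. \<Sum>i<n. indicat_real (A i) x) \<longlonglongrightarrow> indicator (\<Union>i. A i) x" for x
        unfolding eq by (rule LIMSEQ_indicator_UN)
      show "integrable M (\<lambda>x. 1 :: real)" by simp
      show "\<bar>\<Sum>i<n. indicat_real (A i) x\<bar> \<le> 1" for n x unfolding eq by simp
      show "indicat_real (\<Union>i. A i) \<in> borel_measurable borel" using A by auto
    qed
  qed
qed

lemma L1_approx_integrable: "integrable M g \<Longrightarrow> L1_approx M g"
proof (induction rule: integrable_induct)
  case (base A c)
  then have "L1_approx M (\<lambda>x. c * indicator A x)" by (intro L1_approx_cmult L1_approx_indicator) (simp add: sets_M)
  then show ?case by (simp add: mult.commute)
next
  case (add f g)
  then show ?case by (intro L1_approx_add)
next
  case (lim f s)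
  show ?case
  proof (rule L1_approx_LIMSEQ[where w="\<lambda>x. 2 * \<bar>f x\<bar>"])
    show "\<bar>s i x\<bar> \<le> 2 * \<bar>f x\<bar>" for i x using lim(3)[of x i] by (simp add: borel_measurable_M)
    show "f \<in> borel_measurable borel" using lim(4) borel_measurable_integrable borel_measurable_M by blast
  qed (use lim in \<open>auto simp: borel_measurable_M\<close>)
qed

end

section \<open>Countable variational formula on the real line\<close>

definition rat_test :: "nat \<times> (rat \<times> rat) list \<Rightarrow> real \<Rightarrow> real" where
  "rat_test p x = max (- real (fst p)) (min (real (fst p)) (rat_step (snd p) x))"

lemma borel_measurable_rat_test [measurable]: "rat_test p \<in> borel_measurable borel"
  unfolding rat_test_def[abs_def] by measurable

lemma abs_rat_test_le: "\<bar>rat_test p x\<bar> \<le> real (fst p)"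
  by (auto simp: rat_test_def)

text \<open>Lipschitz bound for \<open>exp\<close> below \<open>n\<close>, again from
  \<open>1 + x \<le> exp x\<close>. It turns L1 closeness of bounded test functions into closeness
  of their exponential integrals.\<close>

lemma abs_exp_diff_le:
  fixes a b n :: real
  assumes "\<bar>a\<bar> \<le> n" "\<bar>b\<bar> \<le> n"
  shows "\<bar>exp a - exp b\<bar> \<le> exp n * \<bar>a - b\<bar>"
proof -
  have *: "\<bar>exp a - exp b\<bar> \<le> exp n * \<bar>a - b\<bar>" if "a \<le> b" "b \<le> n" for a b :: real
  proof -
    have "exp b * (1 + (a - b)) \<le> exp b * exp (a - b)" by (intro mult_left_mono) auto
    then have "exp b - exp a \<le> exp b * (b - a)" by (simp add: exp_diff algebra_simps)
    also have "\<dots> \<le> exp n * (b - a)" using that by (intro mult_right_mono) auto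
    finally show ?thesis using that by (simp add: abs_if)
  qed
  show ?thesis using *[of a b] *[of b a] assms by (cases "a \<le> b") (auto simp: abs_minus_commute)
qed

text \<open>One list must serve both measures, so density is applied to the mixture (P + Q)/2,
  realised as a \<open>bind\<close> over a fair coin. An error below \<open>e / 2\<close> for the
  mixture leaves each measure with an error below \<open>e\<close>.\<close>

lemma rat_step_L1_approx_two:
  fixes g :: "real \<Rightarrow> real"
  assumes P: "P \<in> space (prob_algebra borel)" and Q: "Q \<in> space (prob_algebra borel)"
    and g: "g \<in> borel_measurable borel" "\<And>x. \<bar>g x\<bar> \<le> b" and e: "e > 0"
  obtains l where "(\<integral>x. \<bar>g x - rat_step l x\<bar> \<partial>P) < e" "(\<integral>x. \<bar>g x - rat_step l x\<bar> \<partial>Q) < e"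
proof -
  define K where "K = (\<lambda>c. if c then P else Q)"
  define M where "M = measure_pmf (bernoulli_pmf (1/2)) \<bind> K"
  have K: "K \<in> measurable (count_space UNIV) (prob_algebra borel)"
    using P Q by (auto simp: K_def)
  have "measure_pmf (bernoulli_pmf (1/2)) \<in> space (prob_algebra (count_space UNIV))"
    by (simp add: space_prob_algebra measure_pmf.prob_space_axioms)
  then have M: "M \<in> space (prob_algebra borel)" unfolding M_def using K by (rule bind_in_space_prob_algebra)
  note M' = space_prob_algebraD[OF M]
  interpret M: prob_space M by (rule M')
  have int_M: "(\<integral>x. f x \<partial>M) = ((\<integral>x. f x \<partial>P) + (\<integral>x. f x \<partial>Q)) / 2"
    if f: "f \<in> borel_measurable borel" "\<And>x. \<bar>f x\<bar> \<le> b" for f :: "real \<Rightarrow> real" and b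
  proof -
    have "(\<integral>x. f x \<partial>M) = (\<integral>c. (\<integral>x. f x \<partial>K c) \<partial>measure_pmf (bernoulli_pmf (1/2)))"
      unfolding M_def
    proof (rule integral_bind[where K=borel and B'=1 and B=b])
      show "K \<in> measurable (measure_pmf (bernoulli_pmf (1/2))) (subprob_algebra borel)"
        using measurable_prob_algebraD[OF K] by simp
      show "AE x in measure_pmf (bernoulli_pmf (1/2)). emeasure (K x) (space (K x)) \<le> ennreal 1"
        using P Q by (intro AE_I2) (auto simp: K_def space_prob_algebra prob_space.emeasure_space_1)
    qed (use f measure_pmf.finite_measure_axioms in auto)
    then show ?thesis by (simp add: K_def)
  qed
  have "integrable M g" using g by (intro M.integrable_const_bound[where B=b]) (auto simp: M')
  then have "L1_approx M g" using M' by (intro L1_approx_integrable M.finite_measure_axioms) auto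
  then obtain l where l: "(\<integral>x. \<bar>g x - rat_step l x\<bar> \<partial>M) < e / 2"
    using e unfolding L1_approx_def by (meson half_gt_zero)
  obtain b' where b': "\<And>x. \<bar>rat_step l x\<bar> \<le> b'" using rat_step_bounded by blast
  have "(\<integral>x. \<bar>g x - rat_step l x\<bar> \<partial>M) = ((\<integral>x. \<bar>g x - rat_step l x\<bar> \<partial>P) + (\<integral>x. \<bar>g x - rat_step l x\<bar> \<partial>Q)) / 2"
  proof (rule int_M)
    fix x show "\<bar>\<bar>g x - rat_step l x\<bar>\<bar> \<le> b + b'" using g(2)[of x] b'[of x] by linarith
  qed (use g in measurable)
  moreover have "0 \<le> (\<integral>x. \<bar>g x - rat_step l x\<bar> \<partial>P)" "0 \<le> (\<integral>x. \<bar>g x - rat_step l x\<bar> \<partial>Q)" by simp_all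
  moreover have "p < e \<and> q < e" if "m = (p + q) / 2" "0 \<le> p" "0 \<le> q" "m < e / 2" for p q m :: real
    using that by auto
  ultimately show thesis using l by (intro that[of l]) blast+
qed

lemma KL_eq_SUP_rat_test:
  assumes P: "P \<in> space (prob_algebra borel)" and Q: "Q \<in> space (prob_algebra borel)"
  shows "KL P Q = (SUP p. ennreal (dual_val P Q (rat_test p)))"
proof (rule antisym)
  show "(SUP p. ennreal (dual_val P Q (rat_test p))) \<le> KL P Q"
    by (intro SUP_least dual_val_le_KL[OF P Q borel_measurable_rat_test abs_rat_test_le])
  show "KL P Q \<le> (SUP p. ennreal (dual_val P Q (rat_test p)))"
  proof (rule KL_le_dual[OF P Q])
    fix g :: "real \<Rightarrow> real" and b assume g: "g \<in> borel_measurable borel" and "\<And>x. x \<in> space borel \<Longrightarrow> \<bar>g x\<bar> \<le> b"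
    then have b: "\<bar>g x\<bar> \<le> b" for x by simp
    obtain n where n: "b \<le> real n" using real_arch_simple by blast
    have gn: "\<bar>g x\<bar> \<le> real n" for x using b[of x] n by linarith
    interpret P: prob_space P by (rule space_prob_algebraD(1)[OF P])
    interpret Q: prob_space Q by (rule space_prob_algebraD(1)[OF Q])
    note P' = space_prob_algebraD[OF P] and Q' = space_prob_algebraD[OF Q]
    show "ennreal (dual_val P Q g) \<le> (SUP p. ennreal (dual_val P Q (rat_test p)))"
    proof (rule ennreal_le_epsilon)
      fix e :: real assume e: "0 < e"
      \<comment> \<open>Replacing \<open>g\<close> by \<open>h\<close> costs at most
        \<open>d\<close> in the \<open>P\<close>-integral and \<open>exp n * d\<close> in the
        \<open>Q\<close>-integral, in total \<open>e\<close>.\<close>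
      define d where "d = e / (1 + exp (real n))"
      have "d > 0" using e by (simp add: d_def add_pos_pos)
      then obtain l where l: "(\<integral>x. \<bar>g x - rat_step l x\<bar> \<partial>P) < d" "(\<integral>x. \<bar>g x - rat_step l x\<bar> \<partial>Q) < d"
        using rat_step_L1_approx_two[OF P Q g b] by blast
      obtain b' where b': "\<And>x. \<bar>rat_step l x\<bar> \<le> b'" using rat_step_bounded by blast
      define h where "h = rat_test (n, l)"
      have hm[measurable]: "h \<in> borel_measurable borel" by (simp add: h_def)
      have hn: "\<bar>h x\<bar> \<le> real n" for x using abs_rat_test_le[of "(n, l)" x] by (simp add: h_def)
      \<comment> \<open>Clamping to \<open>[-n, n]\<close> is 1-Lipschitz and leaves
        \<open>g\<close> unchanged, so it does not increase the distance.\<close>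
      have gh: "\<bar>g x - h x\<bar> \<le> \<bar>g x - rat_step l x\<bar>" for x
        using gn[of x] by (auto simp: h_def rat_test_def)
      have gs: "\<bar>\<bar>g x - rat_step l x\<bar>\<bar> \<le> b + b'" for x using b[of x] b'[of x] by linarith
      have expn: "exp (g x) \<le> exp (real n)" "exp (h x) \<le> exp (real n)" for x
        using gn[of x] hn[of x] by auto
      have iP: "integrable P g" "integrable P h" "integrable P (\<lambda>x. \<bar>g x - rat_step l x\<bar>)"
        by (rule P.integrable_const_bound[where B="real n"] P.integrable_const_bound[where B="b + b'"];
            use gn hn gs g hm in \<open>simp add: P'\<close>)+
      have iQ: "integrable Q (\<lambda>x. exp (g x))" "integrable Q (\<lambda>x. exp (h x))" "integrable Q (\<lambda>x. \<bar>g x - rat_step l x\<bar>)"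
        by (rule Q.integrable_const_bound[where B="exp (real n)"] Q.integrable_const_bound[where B="b + b'"];
            use expn gs g hm in \<open>simp add: Q'\<close>)+
      have "(\<integral>x. g x \<partial>P) - (\<integral>x. h x \<partial>P) = (\<integral>x. g x - h x \<partial>P)" using iP by simp
      also have "\<dots> \<le> (\<integral>x. \<bar>g x - rat_step l x\<bar> \<partial>P)"
        using iP gh abs_le_D1 by (intro integral_mono) auto
      also have "\<dots> \<le> d" using l by simp
      finally have 1: "(\<integral>x. g x \<partial>P) - (\<integral>x. h x \<partial>P) \<le> d" .
      have "(\<integral>x. exp (h x) \<partial>Q) - (\<integral>x. exp (g x) \<partial>Q) = (\<integral>x. exp (h x) - exp (g x) \<partial>Q)" using iQ by simp
      also have "\<dots> \<le> (\<integral>x. exp (real n) * \<bar>g x - rat_step l x\<bar> \<partial>Q)"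
      proof (intro integral_mono)
        fix x
        have "exp (h x) - exp (g x) \<le> exp (real n) * \<bar>g x - h x\<bar>"
          using abs_exp_diff_le[OF hn[of x] gn[of x]] by (simp add: abs_minus_commute)
        also have "\<dots> \<le> exp (real n) * \<bar>g x - rat_step l x\<bar>" using gh by (intro mult_left_mono) auto
        finally show "exp (h x) - exp (g x) \<le> exp (real n) * \<bar>g x - rat_step l x\<bar>" .
      qed (use iQ in auto)
      also have "\<dots> \<le> exp (real n) * d" using l by simp
      finally have "dual_val P Q g \<le> dual_val P Q h + (1 + exp (real n)) * d"
        using 1 unfolding dual_val_def by (simp add: algebra_simps)
      also have "(1 + exp (real n)) * d = e" using add_pos_pos[OF zero_less_one exp_gt_zero[of "real n"]] by (simp add: d_def)
      finally have "ennreal (dual_val P Q g) \<le> ennreal (dual_val P Q h + e)" by (rule ennreal_leI)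
      also have "\<dots> \<le> ennreal (dual_val P Q h) + ennreal e" by (rule ennreal_add_le)
      also have "\<dots> \<le> (SUP p. ennreal (dual_val P Q (rat_test p))) + ennreal e"
        unfolding h_def by (intro add_right_mono SUP_upper) auto
      finally show "ennreal (dual_val P Q g) \<le> (SUP p. ennreal (dual_val P Q (rat_test p))) + ennreal e" .
    qed
  qed
qed

text \<open>The index set of \<open>rat_test\<close> is countable, and for each index the dual value
  combines two integrals against kernels.\<close>

lemma borel_measurable_KL:
  assumes F: "F \<in> measurable L (prob_algebra (borel :: real measure))" and G: "G \<in> measurable L (prob_algebra borel)"
  shows "(\<lambda>h. KL (F h) (G h)) \<in> borel_measurable L"
proof -
  have "(\<lambda>h. SUP p. ennreal (dual_val (F h) (G h) (rat_test p))) \<in> borel_measurable L"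
  proof (rule borel_measurable_SUP)
    fix p
    have "(\<lambda>h. \<integral>x. rat_test p x \<partial>F h) \<in> borel_measurable L"
      by (rule measurable_compose[OF measurable_prob_algebraD[OF F] integral_measurable_subprob_algebra]) measurable
    moreover have "(\<lambda>h. \<integral>x. exp (rat_test p x) \<partial>G h) \<in> borel_measurable L"
      by (rule measurable_compose[OF measurable_prob_algebraD[OF G] integral_measurable_subprob_algebra]) measurable
    ultimately show "(\<lambda>h. ennreal (dual_val (F h) (G h) (rat_test p))) \<in> borel_measurable L"
      unfolding dual_val_def by measurable
  qed auto
  moreover have "KL (F h) (G h) = (SUP p. ennreal (dual_val (F h) (G h) (rat_test p)))" if "h \<in> space L" for h
    using measurable_space[OF F that] measurable_space[OF G that] by (rule KL_eq_SUP_rat_test)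
  ultimately show ?thesis by (subst measurable_cong) auto
qed

subsection \<open>Autoregressive laws\<close>

lemma space_Dsp: "space (Dsp T) = {1..T} \<rightarrow>\<^sub>E UNIV"
  by (simp add: Dsp_def space_PiM)

lemma trunc_measurable [measurable]: "trunc T s \<in> measurable (Dsp T) (Dsp T)"
  unfolding trunc_def[abs_def] Dsp_def by measurable

lemma trunc_trunc: "trunc T s (trunc T s' y) = trunc T (min s s') y"
  by (auto simp: trunc_def)

lemma upd_measurable:
  assumes "s \<in> {1..T}"
  shows "(\<lambda>(y, z). y(s := z)) \<in> measurable (Dsp T \<Otimes>\<^sub>M borel) (Dsp T)"
proof -
  have "insert s {1..T} = {1..T}" using assms by auto
  then show ?thesis
    using measurable_add_dim[of s "{1..T}" "\<lambda>_. borel :: real measure"] by (simp add: Dsp_def)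
qed

lemma upd_measurable1:
  assumes "s \<in> {1..T}" "y \<in> space (Dsp T)"
  shows "(\<lambda>z. y(s := z)) \<in> measurable borel (Dsp T)"
  using measurable_compose[OF measurable_Pair1'[OF assms(2)] upd_measurable[OF assms(1)]] by simp

definition ar_step :: "nat \<Rightarrow> (nat \<Rightarrow> (nat \<Rightarrow> real) \<Rightarrow> real measure) \<Rightarrow> nat \<Rightarrow> (nat \<Rightarrow> real) \<Rightarrow> (nat \<Rightarrow> real) measure" where
  "ar_step T k s y = distr (k s (trunc T s y)) (Dsp T) (\<lambda>z. y(s := z))"

lemma ar_law_Suc: "ar_law T k (Suc s) = ar_law T k s \<bind> ar_step T k (Suc s)"
  by (simp add: ar_step_def[abs_def])

declare ar_law.simps(2) [simp del]

context
  fixes T :: nat and k :: "nat \<Rightarrow> (nat \<Rightarrow> real) \<Rightarrow> real measure"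
  assumes k: "\<And>s. s \<in> {1..T} \<Longrightarrow> k s \<in> measurable (Dsp T) (prob_algebra borel)"
begin

lemma ar_step_measurable:
  assumes "s \<in> {1..T}"
  shows "ar_step T k s \<in> measurable (Dsp T) (prob_algebra (Dsp T))"
  unfolding ar_step_def[abs_def]
  by (rule measurable_distr_prob_space2[OF measurable_compose[OF trunc_measurable k[OF assms]] upd_measurable[OF assms]])

lemma ar_law_prob: "s \<le> T \<Longrightarrow> ar_law T k s \<in> space (prob_algebra (Dsp T))"
proof (induction s)
  case 0
  show ?case by (simp add: space_prob_algebra, rule prob_space_return) (simp add: space_Dsp)
next
  case (Suc s)
  then show ?case unfolding ar_law_Suc by (intro bind_in_space_prob_algebra[OF _ ar_step_measurable]) auto
qed

lemma space_ar_law_not_empty: "s \<le> T \<Longrightarrow> space (ar_law T k s) \<noteq> {}"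
  using prob_space.not_empty space_prob_algebraD(1)[OF ar_law_prob] by blast

lemma k_prob:
  assumes "s \<in> {1..T}" "y \<in> space (Dsp T)"
  shows "k s (trunc T s y) \<in> space (prob_algebra borel)"
  by (rule measurable_space[OF k[OF assms(1)] measurable_space[OF trunc_measurable assms(2)]])

lemma distr_bind_ar_law:
  assumes "s < T" "f \<in> measurable (Dsp T) L"
  shows "distr (ar_law T k (Suc s)) L f = ar_law T k s \<bind> (\<lambda>y. distr (ar_step T k (Suc s) y) L f)"
proof -
  note A = space_prob_algebraD[OF ar_law_prob[of s]]
  have "space (ar_law T k s) \<noteq> {}" using assms by (intro space_ar_law_not_empty) simp
  moreover have "ar_step T k (Suc s) \<in> measurable (ar_law T k s) (subprob_algebra (Dsp T))"
    using assms measurable_prob_algebraD[OF ar_step_measurable[of "Suc s"]] by (simp add: A(4))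
  ultimately show ?thesis unfolding ar_law_Suc using assms(2) by (intro distr_bind)
qed

text \<open>Generation starts from the zero path and after \<open>s\<close> steps has written
  coordinates 1 to \<open>s\<close> only, so the cut at \<open>Suc s\<close> removes
  nothing.\<close>

lemma trunc_ar_law_self: "s \<le> T \<Longrightarrow> distr (ar_law T k s) (Dsp T) (trunc T (Suc s)) = ar_law T k s"
proof (induction s)
  case 0
  have "trunc T (Suc 0) (\<lambda>i\<in>{1..T}. 0) = (\<lambda>i\<in>{1..T}. 0)" by (auto simp: trunc_def)
  then show ?case by (simp add: distr_return[OF trunc_measurable] space_Dsp)
next
  case (Suc s)
  note A = space_prob_algebraD[OF ar_law_prob[of s]]
  have ne: "space (ar_law T k s) \<noteq> {}" using Suc by (intro space_ar_law_not_empty) simp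
  have sT: "Suc s \<in> {1..T}" using Suc by simp
  \<comment> \<open>The cut commutes with a generation step because the kernel reads only the prefix
    that survives it.\<close>
  have step: "distr (ar_step T k (Suc s) y) (Dsp T) (trunc T (Suc (Suc s))) = ar_step T k (Suc s) (trunc T (Suc s) y)"
    if y: "y \<in> space (Dsp T)" for y
  proof -
    have "trunc T (Suc (Suc s)) (y(Suc s := z)) = (trunc T (Suc s) y)(Suc s := z)" for z
      using sT by (auto simp: trunc_def fun_eq_iff)
    then show ?thesis unfolding ar_step_def
      using upd_measurable1[OF sT y]
      by (subst distr_distr) (auto simp: comp_def trunc_trunc space_prob_algebraD(4)[OF k_prob[OF sT y]])
  qed
  have "distr (ar_law T k (Suc s)) (Dsp T) (trunc T (Suc (Suc s)))
    = ar_law T k s \<bind> (\<lambda>y. distr (ar_step T k (Suc s) y) (Dsp T) (trunc T (Suc (Suc s))))"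
    using Suc by (intro distr_bind_ar_law) auto
  also have "\<dots> = ar_law T k s \<bind> (\<lambda>y. ar_step T k (Suc s) (trunc T (Suc s) y))"
    using step A(3) Suc by (intro bind_cong) auto
  also have "\<dots> = distr (ar_law T k s) (Dsp T) (trunc T (Suc s)) \<bind> ar_step T k (Suc s)"
    using Suc ne measurable_prob_algebraD[OF ar_step_measurable[OF sT]]
    by (subst bind_distr[where K="Dsp T"]) (auto simp: A(4))
  also have "\<dots> = ar_law T k (Suc s)" using Suc by (simp add: ar_law_Suc)
  finally show ?case .
qed

text \<open>Steps after \<open>s\<close> write coordinates that the cut resets to 0, so each of them
  becomes a point mass. This links the \<open>n\<close>-step laws of the chain rule with the full
  law inside \<open>step_KL\<close>.\<close>

lemma trunc_ar_law: "s \<le> n \<Longrightarrow> n \<le> T \<Longrightarrow> distr (ar_law T k n) (Dsp T) (trunc T (Suc s)) = ar_law T k s"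
proof (induction n rule: dec_induct)
  case base
  then show ?case by (rule trunc_ar_law_self)
next
  case (step n)
  note A = space_prob_algebraD[OF ar_law_prob[of n]]
  have ne: "space (ar_law T k n) \<noteq> {}" using step by (intro space_ar_law_not_empty) simp
  have sT: "Suc n \<in> {1..T}" using step by simp
  have const: "distr (ar_step T k (Suc n) y) (Dsp T) (trunc T (Suc s)) = return (Dsp T) (trunc T (Suc s) y)"
    if y: "y \<in> space (Dsp T)" for y
  proof -
    interpret prob_space "k (Suc n) (trunc T (Suc n) y)" using space_prob_algebraD(1)[OF k_prob[OF sT y]] .
    have "trunc T (Suc s) (y(Suc n := z)) = trunc T (Suc s) y" for z
      using step by (auto simp: trunc_def fun_eq_iff)
    then show ?thesis unfolding ar_step_def
      using upd_measurable1[OF sT y] measurable_space[OF trunc_measurable y]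
      by (subst distr_distr) (auto simp: comp_def distr_const space_prob_algebraD(4)[OF k_prob[OF sT y]])
  qed
  have "distr (ar_law T k (Suc n)) (Dsp T) (trunc T (Suc s))
    = ar_law T k n \<bind> (\<lambda>y. distr (ar_step T k (Suc n) y) (Dsp T) (trunc T (Suc s)))"
    using step by (intro distr_bind_ar_law) auto
  also have "\<dots> = ar_law T k n \<bind> (\<lambda>y. return (Dsp T) (trunc T (Suc s) y))"
    using const A(3) step by (intro bind_cong) auto
  also have "\<dots> = distr (ar_law T k n) (Dsp T) (trunc T (Suc s))"
    using ne step by (intro bind_return_distr') (auto simp: A(4))
  also have "\<dots> = ar_law T k s" using step by simp
  finally show ?case .
qed

lemma first_coordinate_ar_law:
  assumes "1 \<le> T"
  shows "distr (ar_law T k T) borel (\<lambda>y. y 1) = k 1 (trunc T 1 (\<lambda>_. 0))"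
proof -
  let ?z = "\<lambda>i\<in>{1..T}. 0 :: real"
  note A = space_prob_algebraD[OF ar_law_prob[of T]]
  have z: "?z \<in> space (Dsp T)" by (simp add: space_Dsp)
  have one: "1 \<in> {1..T}" using assms by simp
  have ev: "(\<lambda>y. y 1) \<in> measurable (Dsp T) borel" unfolding Dsp_def using one by measurable
  have t: "trunc T 1 ?z = trunc T 1 (\<lambda>_. 0)" by (auto simp: trunc_def)
  have kp: "k 1 (trunc T 1 (\<lambda>_. 0)) \<in> space (prob_algebra borel)" using k_prob[OF one z] t by simp
  have "(\<lambda>y. y 1) \<circ> trunc T (Suc 1) = (\<lambda>y. y 1)" using assms by (auto simp: trunc_def fun_eq_iff)
  then have "distr (ar_law T k T) borel (\<lambda>y. y 1) = distr (distr (ar_law T k T) (Dsp T) (trunc T (Suc 1))) borel (\<lambda>y. y 1)"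
    using ev by (subst distr_distr) (auto simp: A(4))
  also have "\<dots> = distr (ar_law T k 1) borel (\<lambda>y. y 1)" using assms by (subst trunc_ar_law) auto
  also have "ar_law T k 1 = return (Dsp T) ?z \<bind> ar_step T k 1" using ar_law_Suc[of T k 0] by simp
  also have "\<dots> = ar_step T k 1 ?z" by (rule bind_return[OF measurable_prob_algebraD[OF ar_step_measurable[OF one]] z])
  also have "distr (ar_step T k 1 ?z) borel (\<lambda>y. y 1) = distr (k 1 (trunc T 1 (\<lambda>_. 0))) borel (\<lambda>z. z)"
    unfolding ar_step_def t using upd_measurable1[OF one z] ev
    by (subst distr_distr) (auto simp: comp_def space_prob_algebraD(4)[OF kp] simp del: One_nat_def)
  also have "\<dots> = k 1 (trunc T 1 (\<lambda>_. 0))" using space_prob_algebraD(2)[OF kp] by (intro distr_id2) simp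
  finally show ?thesis .
qed

end

text \<open>Chain rule, by induction on the number of generated coordinates. Writing the new
  coordinate into the path is a pushforward, so by data processing a step costs at most the
  divergence of the two kernels.\<close>

lemma KL_ar_law_le:
  assumes k: "\<And>s. s \<in> {1..T} \<Longrightarrow> k s \<in> measurable (Dsp T) (prob_algebra borel)"
    and k': "\<And>s. s \<in> {1..T} \<Longrightarrow> k' s \<in> measurable (Dsp T) (prob_algebra borel)"
  shows "n \<le> T \<Longrightarrow> KL (ar_law T k n) (ar_law T k' n) \<le> (\<Sum>s\<in>{1..n}. step_KL T k k' s)"
proof (induction n)
  case 0
  have z: "return (Dsp T) (\<lambda>i\<in>{1..T}. 0) \<in> space (prob_algebra (Dsp T))" using ar_law_prob[of T k 0, OF k] by simp
  interpret prob_space "return (Dsp T) (\<lambda>i\<in>{1..T}. 0)" using space_prob_algebraD(1)[OF z] .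
  \<comment> \<open>Equal point masses give dual value at most 0 for every test function, by
    \<open>1 + x \<le> exp x\<close>.\<close>
  have "KL (return (Dsp T) (\<lambda>i\<in>{1..T}. 0)) (return (Dsp T) (\<lambda>i\<in>{1..T}. 0)) \<le> 0"
  proof (rule KL_le_dual[OF z z])
    fix g :: "(nat \<Rightarrow> real) \<Rightarrow> real" and b
    assume "g \<in> borel_measurable (Dsp T)"
    then have "dual_val (return (Dsp T) (\<lambda>i\<in>{1..T}. 0)) (return (Dsp T) (\<lambda>i\<in>{1..T}. 0)) g
      = g (\<lambda>i\<in>{1..T}. 0) - (exp (g (\<lambda>i\<in>{1..T}. 0)) - 1)"
      unfolding dual_val_def by (subst (1 2) integral_return) (auto simp: space_Dsp)
    also have "\<dots> \<le> 0" using exp_ge_add_one_self[of "g (\<lambda>i\<in>{1..T}. 0)"] by linarith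
    finally show "ennreal (dual_val (return (Dsp T) (\<lambda>i\<in>{1..T}. 0)) (return (Dsp T) (\<lambda>i\<in>{1..T}. 0)) g) \<le> 0"
      by (simp add: ennreal_neg)
  qed
  then show ?case by simp
next
  case (Suc n)
  have sT: "Suc n \<in> {1..T}" using Suc by simp
  have n: "n \<le> T" using Suc by simp
  have "ar_law T k n \<in> space (prob_algebra (Dsp T))" "ar_law T k T \<in> space (prob_algebra (Dsp T))"
    using k n by (auto intro: ar_law_prob)
  note A = space_prob_algebraD[OF this(1)] and AT = space_prob_algebraD[OF this(2)]
  have "KL (ar_law T k (Suc n)) (ar_law T k' (Suc n))
    \<le> KL (ar_law T k n) (ar_law T k' n) + (\<integral>\<^sup>+y. KL (ar_step T k (Suc n) y) (ar_step T k' (Suc n) y) \<partial>ar_law T k n)"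
    unfolding ar_law_Suc
    using ar_law_prob[of T k n] ar_law_prob[of T k' n] ar_step_measurable[of T k "Suc n"] ar_step_measurable[of T k' "Suc n"] k k' sT n
    by (intro KL_bind_le) auto
  also have "\<dots> \<le> (\<Sum>s\<in>{1..n}. step_KL T k k' s) + step_KL T k k' (Suc n)"
  proof (rule add_mono)
    show "KL (ar_law T k n) (ar_law T k' n) \<le> (\<Sum>s\<in>{1..n}. step_KL T k k' s)" using Suc by simp
    have "(\<integral>\<^sup>+y. KL (ar_step T k (Suc n) y) (ar_step T k' (Suc n) y) \<partial>ar_law T k n)
      \<le> (\<integral>\<^sup>+y. KL (k (Suc n) (trunc T (Suc n) y)) (k' (Suc n) (trunc T (Suc n) y)) \<partial>ar_law T k n)"
    proof (rule nn_integral_mono)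
      fix y assume "y \<in> space (ar_law T k n)"
      then have y: "y \<in> space (Dsp T)" by (simp add: A)
      show "KL (ar_step T k (Suc n) y) (ar_step T k' (Suc n) y) \<le> KL (k (Suc n) (trunc T (Suc n) y)) (k' (Suc n) (trunc T (Suc n) y))"
        unfolding ar_step_def
        using k_prob[of T k, OF k sT y] k_prob[of T k', OF k' sT y] upd_measurable1[OF sT y] by (intro KL_distr_le)
    qed
    \<comment> \<open>\<open>trunc T (Suc n)\<close> keeps coordinates 1 to \<open>n\<close>; their
      law is the same after \<open>n\<close> steps and after all \<open>T\<close> steps, and the
      integrand sees nothing else.\<close>
    also have "\<dots> = (\<integral>\<^sup>+y. KL (k (Suc n) (trunc T (Suc n) y)) (k' (Suc n) (trunc T (Suc n) y))
        \<partial>distr (ar_law T k T) (Dsp T) (trunc T (Suc n)))"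
      using trunc_ar_law[of T k n T, OF k n] by simp
    also have "\<dots> \<le> step_KL T k k' (Suc n)"
      using nn_integral_distr_le[of "trunc T (Suc n)" "ar_law T k T" "Dsp T"
          "\<lambda>y. KL (k (Suc n) (trunc T (Suc n) y)) (k' (Suc n) (trunc T (Suc n) y))"]
      by (simp add: step_KL_def trunc_trunc AT(4))
    finally show "(\<integral>\<^sup>+y. KL (ar_step T k (Suc n) y) (ar_step T k' (Suc n) y) \<partial>ar_law T k n) \<le> step_KL T k k' (Suc n)" .
  qed
  finally show ?case by (simp add: add.commute)
qed

text \<open>\<open>trunc T 1\<close> forgets every coordinate, so the integrand is constant. Thus
  d(h) is the term \<open>s = 1\<close> of the chain rule.\<close>

lemma step_KL_1:
  assumes "\<And>s. s \<in> {1..T} \<Longrightarrow> k s \<in> measurable (Dsp T) (prob_algebra borel)"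
  shows "step_KL T k k' 1 = first_KL T k k'"
proof -
  interpret prob_space "ar_law T k T" using space_prob_algebraD(1)[OF ar_law_prob[of T k T]] assms by blast
  have "trunc T 1 y = trunc T 1 (\<lambda>_. 0)" for y by (auto simp: trunc_def)
  then show ?thesis unfolding step_KL_def first_KL_def by (metis (no_types, lifting) emeasure_space_1 mult.right_neutral nn_integral_const nn_integral_cong)
qed

subsection \<open>Censored observations and exploration\<close>

lemma psi_measurable: "psi x \<in> measurable borel Osp"
  unfolding psi_def[abs_def] Osp_def by measurable

text \<open>Mass of \<open>P\<close> above \<open>B\<close> is seen by the second component of the observation, where \<open>Q\<close> has no
  mass; so either the right-hand side is infinite or \<^const>\<open>fst\<close> inverts \<open>psi B\<close> almost surely.\<close>

lemma KL_le_KL_obs_law: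
  assumes P: "P \<in> space (prob_algebra borel)" and Q: "Q \<in> space (prob_algebra borel)"
    and QB: "AE d in Q. d \<le> B"
  shows "KL P Q \<le> KL (obs_law B P) (obs_law B Q)"
proof (cases "absolutely_continuous (obs_law B Q) (obs_law B P)")
  case True
  note P' = space_prob_algebraD[OF P] and Q' = space_prob_algebraD[OF Q]
  have mP: "psi B \<in> measurable P Osp" and mQ: "psi B \<in> measurable Q Osp"
    using psi_measurable by (auto simp: P' Q')
  have fst: "fst \<in> measurable Osp (borel :: real measure)" unfolding Osp_def by measurable
  have obs: "obs_law B P \<in> space (prob_algebra Osp)" "obs_law B Q \<in> space (prob_algebra Osp)"
    using mP mQ P'(1) Q'(1) by (auto simp: obs_law_def space_prob_algebra intro: prob_space.prob_space_distr)
  let ?A = "{p \<in> space Osp. \<not> snd p}"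
  have A: "?A \<in> sets Osp" unfolding Osp_def by measurable
  have vA: "psi B -` ?A \<inter> UNIV = {d. \<not> d \<le> B}"
    using measurable_space[OF psi_measurable] by (auto simp: psi_def)
  have "emeasure (obs_law B Q) ?A = emeasure Q {d. \<not> d \<le> B}"
    unfolding obs_law_def using emeasure_distr[OF mQ A] vA by (simp add: Q')
  also have "\<dots> = 0"
    using QB by (subst (asm) AE_iff_measurable[OF _ refl]) (auto simp: Q')
  finally have "?A \<in> null_sets (obs_law B Q)" using A by (auto simp: obs_law_def)
  then have "?A \<in> null_sets (obs_law B P)" using True by (auto simp: absolutely_continuous_def)
  then have "emeasure P {d. \<not> d \<le> B} = 0"
    unfolding obs_law_def null_sets_def using emeasure_distr[OF mP A] vA by (simp add: P')
  then have PB: "AE d in P. d \<le> B"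
    by (subst AE_iff_measurable[OF _ refl]) (auto simp: P')
  have fst_obs: "distr (obs_law B R) borel fst = R"
    if R: "R \<in> space (prob_algebra borel)" "AE d in R. d \<le> B" for R
  proof -
    note R' = space_prob_algebraD[OF R(1)]
    have "distr (obs_law B R) borel fst = distr R borel (fst \<circ> psi B)"
      unfolding obs_law_def using psi_measurable fst by (subst distr_distr) (auto simp: R')
    also have "\<dots> = distr R borel (\<lambda>d. d)"
      using R(2) psi_measurable fst by (intro distr_cong_AE) (auto simp: R' psi_def min_def)
    also have "\<dots> = R" using R'(2) by (intro distr_id2) simp
    finally show ?thesis .
  qed
  show ?thesis using KL_distr_le[OF obs fst] fst_obs[OF P PB] fst_obs[OF Q QB] by simp
qed (simp add: KL_def)

section \<open>Generation order and time order\<close>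

lemma to_time_measurable:
  assumes "bij_betw \<sigma> {1..T} {1..T}"
  shows "to_time T \<sigma> \<in> measurable (Dsp T) (Dsp T)"
  unfolding to_time_def[abs_def] Dsp_def
proof (rule measurable_restrict)
  fix i assume "i \<in> {1..T}"
  then have "inv_into {1..T} \<sigma> i \<in> {1..T}" using bij_betw_inv_into[OF assms] by (auto dest: bij_betwE)
  then show "(\<lambda>y. y (inv_into {1..T} \<sigma> i)) \<in> borel_measurable (PiM {1..T} (\<lambda>_. borel))" by measurable
qed

lemma marg_to_time_ar_law:
  assumes k: "\<And>s. s \<in> {1..T} \<Longrightarrow> k s \<in> measurable (Dsp T) (prob_algebra borel)"
    and \<sigma>: "bij_betw \<sigma> {1..T} {1..T}" "\<sigma> 1 = t" and t: "t \<in> {1..T}"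
  shows "marg (distr (ar_law T k T) (Dsp T) (to_time T \<sigma>)) t = k 1 (trunc T 1 (\<lambda>_. 0))"
proof -
  have "ar_law T k T \<in> space (prob_algebra (Dsp T))" using k by (auto intro: ar_law_prob)
  note A = space_prob_algebraD[OF this]
  have one: "1 \<in> {1..T}" using t by simp
  have "inv_into {1..T} \<sigma> t = 1"
    using inv_into_f_f[OF bij_betw_imp_inj_on[OF \<sigma>(1)] one] \<sigma>(2) by simp
  then have "(\<lambda>D. D t) \<circ> to_time T \<sigma> = (\<lambda>y. y 1)" using t by (auto simp: to_time_def fun_eq_iff)
  moreover have "(\<lambda>D. D t) \<in> measurable (Dsp T) borel" unfolding Dsp_def using t by measurable
  ultimately have "marg (distr (ar_law T k T) (Dsp T) (to_time T \<sigma>)) t = distr (ar_law T k T) borel (\<lambda>y. y 1)"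
    unfolding marg_def using to_time_measurable[OF \<sigma>(1)] by (subst distr_distr) (auto simp: A(4))
  also have "\<dots> = k 1 (trunc T 1 (\<lambda>_. 0))" using t by (intro first_coordinate_ar_law k) auto
  finally show ?thesis .
qed

section \<open>Harmonic weights of the step control\<close>

lemma sum_inverse_le_ln:
  assumes "1 \<le> n"
  shows "(\<Sum>s\<in>{2..n}. 1 / real s) \<le> ln (real n)"
  using assms
proof (induction n rule: nat_induct_at_least)
  case (Suc n)
  have n: "real n > 0" using Suc by simp
  \<comment> \<open>\<open>ln x \<le> x - 1\<close> at \<open>x = n / (n + 1)\<close> bounds
    \<open>1 / (n + 1)\<close> by an increment of \<open>ln\<close>, and the increments
    telescope.\<close>
  have "ln (real n / real (Suc n)) \<le> real n / real (Suc n) - 1" using n by (intro ln_le_minus_one) simp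
  also have "\<dots> = - (1 / real (Suc n))" by (simp add: field_simps)
  finally have "1 / real (Suc n) \<le> ln (real (Suc n)) - ln (real n)" using n by (simp add: ln_div)
  moreover have "(\<Sum>s\<in>{2..Suc n}. 1 / real s) = (\<Sum>s\<in>{2..n}. 1 / real s) + 1 / real (Suc n)"
    using Suc by (subst sum.nat_ivl_Suc') auto
  ultimately show ?case using Suc by linarith
qed simp

lemma KL_ar_law_le_first_KL:
  assumes k: "\<And>s. s \<in> {1..T} \<Longrightarrow> k s \<in> measurable (Dsp T) (prob_algebra borel)"
    and k': "\<And>s. s \<in> {1..T} \<Longrightarrow> k' s \<in> measurable (Dsp T) (prob_algebra borel)"
    and T: "1 \<le> T" and c: "0 < c"
    and step: "\<And>s. s \<in> {2..T} \<Longrightarrow> step_KL T k k' s \<le> ennreal (c / real s) * first_KL T k k'"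
  shows "KL (ar_law T k T) (ar_law T k' T) \<le> ennreal (1 + c * ln (real T)) * first_KL T k k'"
proof -
  have "{1..T} = insert 1 {2..T}" using T by auto
  then have "KL (ar_law T k T) (ar_law T k' T) \<le> step_KL T k k' 1 + (\<Sum>s\<in>{2..T}. step_KL T k k' s)"
    using KL_ar_law_le[OF k k' le_refl] by simp
  also have "\<dots> \<le> first_KL T k k' + (\<Sum>s\<in>{2..T}. ennreal (c / real s) * first_KL T k k')"
    using step step_KL_1[of T k k', OF k] by (intro add_mono sum_mono) auto
  also have "\<dots> = (1 + (\<Sum>s\<in>{2..T}. ennreal (c / real s))) * first_KL T k k'"
    by (simp add: distrib_right sum_distrib_right)
  also have "(\<Sum>s\<in>{2..T}. ennreal (c / real s)) = ennreal (\<Sum>s\<in>{2..T}. c / real s)"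
    using c by (intro sum_ennreal) auto
  also have "(\<Sum>s\<in>{2..T}. c / real s) = c * (\<Sum>s\<in>{2..T}. 1 / real s)" by (simp add: sum_distrib_left)
  also have "1 + ennreal (c * (\<Sum>s\<in>{2..T}. 1 / real s)) = ennreal (1 + c * (\<Sum>s\<in>{2..T}. 1 / real s))"
    using c by (subst ennreal_plus) (auto intro!: mult_nonneg_nonneg sum_nonneg)
  also have "\<dots> \<le> ennreal (1 + c * ln (real T))"
    using c sum_inverse_le_ln[OF T] by (intro ennreal_leI add_left_mono mult_left_mono) auto
  finally show ?thesis by (simp add: mult_right_mono)
qed

section \<open>Conditioning on the history\<close>

lemma hist_measurable:
  assumes "\<And>s. s \<in> {1..<t} \<Longrightarrow> X s \<in> borel_measurable M" "\<And>s. s \<in> {1..<t} \<Longrightarrow> D s \<in> borel_measurable M"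
  shows "hist X D t \<in> measurable M (Hsp t)"
  unfolding hist_def[abs_def] Hsp_def
proof (rule measurable_restrict)
  fix s assume "s \<in> {1..<t}"
  then have [measurable]: "X s \<in> borel_measurable M" "D s \<in> borel_measurable M" using assms by auto
  show "(\<lambda>\<omega>. (X s \<omega>, psi (X s \<omega>) (D s \<omega>))) \<in> measurable M (borel \<Otimes>\<^sub>M Osp)"
    unfolding Osp_def psi_def by measurable
qed

text \<open>By \<open>cond\<close>, \<open>p (H \<omega>)\<close> is a version of the conditional
  probability of \<open>E\<close> given \<open>H\<close>. Hence \<open>M\<close> restricted to
  \<open>E\<close> and pushed forward by \<open>H\<close> has density \<open>p\<close> with respect
  to the law of \<open>H\<close>; integrating the measurable \<open>F\<close> against both
  descriptions turns the indicator into \<open>p\<close>, which is at least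
  \<open>\<eta>\<close>.\<close>

lemma nn_integral_conditional_prob_ge:
  assumes M: "prob_space M" and H: "H \<in> measurable M N" and E: "E \<in> sets M"
    and p: "p \<in> borel_measurable N" "\<And>h. h \<in> space N \<Longrightarrow> 0 \<le> p h \<and> p h \<le> 1"
    and cond: "\<And>A. A \<in> sets N \<Longrightarrow> measure M {\<omega> \<in> space M. H \<omega> \<in> A \<and> \<omega> \<in> E} = (\<integral>\<omega>. indicator A (H \<omega>) * p (H \<omega>) \<partial>M)"
    and ge: "AE \<omega> in M. \<eta> \<le> p (H \<omega>)" and F: "F \<in> borel_measurable N"
  shows "ennreal \<eta> * (\<integral>\<^sup>+\<omega>. F (H \<omega>) \<partial>M) \<le> (\<integral>\<^sup>+\<omega>. F (H \<omega>) * indicator E \<omega> \<partial>M)"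
proof -
  interpret prob_space M by fact
  note [measurable] = H E p(1) F
  have eq: "distr (density M (indicator E)) N H = density (distr M N H) (\<lambda>h. ennreal (p h))"
  proof (rule measure_eqI)
    fix A assume "A \<in> sets (distr (density M (indicator E)) N H)"
    then have A[measurable]: "A \<in> sets N" by simp
    have pH: "0 \<le> p (H \<omega>)" "p (H \<omega>) \<le> 1" if "\<omega> \<in> space M" for \<omega>
      using p(2) measurable_space[OF H that] by auto
    have i: "integrable M (\<lambda>\<omega>. indicator A (H \<omega>) * p (H \<omega>))"
      using pH by (intro integrable_const_bound[where B=1]) (auto simp: indicator_def intro!: AE_I2)
    have "emeasure (distr (density M (indicator E)) N H) A = emeasure (density M (indicator E)) (H -` A \<inter> space M)"
      by (subst emeasure_distr) auto
    also have "\<dots> = (\<integral>\<^sup>+\<omega>. indicator {\<omega> \<in> space M. H \<omega> \<in> A \<and> \<omega> \<in> E} \<omega> \<partial>M)"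
      by (subst emeasure_density)
        (auto simp del: nn_integral_indicator intro!: nn_integral_cong split: split_indicator)
    also have "\<dots> = ennreal (measure M {\<omega> \<in> space M. H \<omega> \<in> A \<and> \<omega> \<in> E})"
      by (subst nn_integral_indicator) (auto simp: emeasure_eq_measure)
    also have "\<dots> = (\<integral>\<^sup>+\<omega>. ennreal (indicator A (H \<omega>) * p (H \<omega>)) \<partial>M)"
      unfolding cond[OF A] using pH by (intro nn_integral_eq_integral[symmetric] i) (auto intro!: AE_I2)
    also have "\<dots> = (\<integral>\<^sup>+\<omega>. ennreal (p (H \<omega>)) * indicator A (H \<omega>) \<partial>M)"
      by (intro nn_integral_cong) (auto simp: indicator_def)
    also have "\<dots> = emeasure (density (distr M N H) (\<lambda>h. ennreal (p h))) A"
      by (subst emeasure_density) (auto simp: nn_integral_distr)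
    finally show "emeasure (distr (density M (indicator E)) N H) A = emeasure (density (distr M N H) (\<lambda>h. ennreal (p h))) A" .
  qed simp
  have "ennreal \<eta> * (\<integral>\<^sup>+\<omega>. F (H \<omega>) \<partial>M) = (\<integral>\<^sup>+\<omega>. ennreal \<eta> * F (H \<omega>) \<partial>M)"
    by (subst nn_integral_cmult) auto
  also have "\<dots> \<le> (\<integral>\<^sup>+\<omega>. ennreal (p (H \<omega>)) * F (H \<omega>) \<partial>M)"
    using ge by (intro nn_integral_mono_AE) (auto elim!: eventually_mono intro!: mult_right_mono ennreal_leI)
  also have "\<dots> = (\<integral>\<^sup>+h. F h \<partial>density (distr M N H) (\<lambda>h. ennreal (p h)))"
    by (subst nn_integral_density) (auto simp: nn_integral_distr)
  also have "\<dots> = (\<integral>\<^sup>+h. F h \<partial>distr (density M (indicator E)) N H)" by (simp add: eq)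
  also have "\<dots> = (\<integral>\<^sup>+\<omega>. F (H \<omega>) * indicator E \<omega> \<partial>M)"
    by (subst nn_integral_distr) (auto simp: nn_integral_density mult.commute)
  finally show ?thesis .
qed

theorem theorem3p6:
  fixes M :: "'w measure"
    and X D :: "nat \<Rightarrow> 'w \<Rightarrow> real"
    and T :: nat and B \<eta> c :: real
    and \<pi> :: "nat \<Rightarrow> (nat \<Rightarrow> real \<times> real \<times> bool) \<Rightarrow> real measure"
    and Qs Qth :: "nat \<Rightarrow> (nat \<Rightarrow> real \<times> real \<times> bool) \<Rightarrow> (nat \<Rightarrow> real) measure"
    and qs qth :: "nat \<Rightarrow> (nat \<Rightarrow> real \<times> real \<times> bool) \<Rightarrow> nat \<Rightarrow> (nat \<Rightarrow> real) \<Rightarrow> real measure"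
    and \<sigma> :: "nat \<Rightarrow> (nat \<Rightarrow> real \<times> real \<times> bool) \<Rightarrow> nat \<Rightarrow> nat"
  assumes M: "prob_space M"
    and T: "1 \<le> T" and B: "0 < B"
    and X_meas: "\<And>t. t \<in> {1..T} \<Longrightarrow> X t \<in> borel_measurable M"
    and D_meas: "\<And>t. t \<in> {1..T} \<Longrightarrow> D t \<in> borel_measurable M"
    and X_range: "\<And>t \<omega>. t \<in> {1..T} \<Longrightarrow> \<omega> \<in> space M \<Longrightarrow> X t \<omega> \<in> {0..B}"
    and D_range: "\<And>t. t \<in> {1..T} \<Longrightarrow> AE \<omega> in M. D t \<omega> \<in> {0..B}"
    \<comment> \<open>deployed policy: X_t given (H_{t-1}, D_{1:T}) has law pi t H_{t-1}\<close>
    and pi_kernel: "\<And>t. t \<in> {1..T} \<Longrightarrow> \<pi> t \<in> measurable (Hsp t) (prob_algebra borel)"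
    and pi_law: "\<And>t A C E. t \<in> {1..T} \<Longrightarrow> A \<in> sets (Hsp t) \<Longrightarrow> C \<in> sets (Dsp T) \<Longrightarrow> E \<in> sets borel \<Longrightarrow>
        measure M {\<omega> \<in> space M. hist X D t \<omega> \<in> A \<and> dpath T D \<omega> \<in> C \<and> X t \<omega> \<in> E}
        = (\<integral>\<omega>. indicator A (hist X D t \<omega>) * indicator C (dpath T D \<omega>)
                  * measure (\<pi> t (hist X D t \<omega>)) E \<partial>M)"
    \<comment> \<open>Q*_t(.|h): true conditional law of D_{1:T} given H_{t-1} = h\<close>
    and Qs_kernel: "\<And>t. t \<in> {1..T} \<Longrightarrow> Qs t \<in> measurable (Hsp t) (prob_algebra (Dsp T))"
    and Qs_law: "\<And>t A C. t \<in> {1..T} \<Longrightarrow> A \<in> sets (Hsp t) \<Longrightarrow> C \<in> sets (Dsp T) \<Longrightarrow>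
        measure M {\<omega> \<in> space M. hist X D t \<omega> \<in> A \<and> dpath T D \<omega> \<in> C}
        = (\<integral>\<omega>. indicator A (hist X D t \<omega>) * measure (Qs t (hist X D t \<omega>)) C \<partial>M)"
    \<comment> \<open>Q_{t,theta}(.|h): learned law on [0,B]^T\<close>
    and Qth_kernel: "\<And>t. t \<in> {1..T} \<Longrightarrow> Qth t \<in> measurable (Hsp t) (prob_algebra (Dsp T))"
    and Qth_support: "\<And>t h. t \<in> {1..T} \<Longrightarrow> h \<in> space (Hsp t) \<Longrightarrow>
        emeasure (Qth t h) (PiE {1..T} (\<lambda>_. {0..B})) = 1"
    \<comment> \<open>autoregressive factorizations in a common generation order sigma, sigma 1 = t\<close>
    and sigma_bij: "\<And>t h. t \<in> {1..T} \<Longrightarrow> h \<in> space (Hsp t) \<Longrightarrow> bij_betw (\<sigma> t h) {1..T} {1..T}"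
    and sigma_first: "\<And>t h. t \<in> {1..T} \<Longrightarrow> h \<in> space (Hsp t) \<Longrightarrow> \<sigma> t h 1 = t"
    and qs_kernel: "\<And>t h s. t \<in> {1..T} \<Longrightarrow> h \<in> space (Hsp t) \<Longrightarrow> s \<in> {1..T} \<Longrightarrow>
        qs t h s \<in> measurable (Dsp T) (prob_algebra borel)"
    and qth_kernel: "\<And>t h s. t \<in> {1..T} \<Longrightarrow> h \<in> space (Hsp t) \<Longrightarrow> s \<in> {1..T} \<Longrightarrow>
        qth t h s \<in> measurable (Dsp T) (prob_algebra borel)"
    and Qs_fact: "\<And>t h. t \<in> {1..T} \<Longrightarrow> h \<in> space (Hsp t) \<Longrightarrow>
        Qs t h = distr (ar_law T (qs t h) T) (Dsp T) (to_time T (\<sigma> t h))"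
    and Qth_fact: "\<And>t h. t \<in> {1..T} \<Longrightarrow> h \<in> space (Hsp t) \<Longrightarrow>
        Qth t h = distr (ar_law T (qth t h) T) (Dsp T) (to_time T (\<sigma> t h))"
    \<comment> \<open>(1) forced exploration of the action B\<close>
    and eta: "0 < \<eta>"
    and explore: "\<And>t. t \<in> {1..T} \<Longrightarrow> AE \<omega> in M. ennreal \<eta> \<le> emeasure (\<pi> t (hist X D t \<omega>)) {B}"
    \<comment> \<open>(2) step-control of later autoregressive conditionals\<close>
    and c: "0 < c"
    and step_control: "\<And>t. t \<in> {1..T} \<Longrightarrow> AE \<omega> in M. \<forall>s\<in>{2..T}.
        step_KL T (qs t (hist X D t \<omega>)) (qth t (hist X D t \<omega>)) s
          \<le> ennreal (c / real s) * first_KL T (qs t (hist X D t \<omega>)) (qth t (hist X D t \<omega>))"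
  shows "Delta_comp M X D T Qs Qth
           \<le> ennreal ((1 + c * ln (real T)) / \<eta>) * Delta_obs M X D T Qs Qth"
proof -
  interpret prob_space M by (rule M)
  have K_nonneg: "0 \<le> 1 + c * ln (real T)" using T c by simp
  have step: "(\<integral>\<^sup>+ \<omega>. KL (Qs t (hist X D t \<omega>)) (Qth t (hist X D t \<omega>)) \<partial>M)
      \<le> ennreal ((1 + c * ln (real T)) / \<eta>) *
        (\<integral>\<^sup>+ \<omega>. KL (obs_law (X t \<omega>) (marg (Qs t (hist X D t \<omega>)) t))
                   (obs_law (X t \<omega>) (marg (Qth t (hist X D t \<omega>)) t)) \<partial>M)"
    if t: "t \<in> {1..T}" for t
  proof -
    define H where "H = hist X D t"
    define d where "d = (\<lambda>h. KL (marg (Qs t h) t) (marg (Qth t h) t))"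
    define E where "E = {\<omega> \<in> space M. X t \<omega> = B}"
    have H: "H \<in> measurable M (Hsp t)"
      unfolding H_def using t X_meas D_meas by (intro hist_measurable) auto
    have Hs: "H \<omega> \<in> space (Hsp t)" if "\<omega> \<in> space M" for \<omega> using measurable_space[OF H that] .
    have E: "E \<in> sets M" unfolding E_def using X_meas[OF t] by measurable
    have coord: "(\<lambda>y. y t) \<in> measurable (Dsp T) borel" unfolding Dsp_def using t by measurable
    have margQs: "(\<lambda>h. marg (Qs t h) t) \<in> measurable (Hsp t) (prob_algebra borel)"
      and margQth: "(\<lambda>h. marg (Qth t h) t) \<in> measurable (Hsp t) (prob_algebra borel)"
      unfolding marg_def
      using measurable_compose[OF Qs_kernel[OF t] measurable_distr_prob_space[OF coord]]
        measurable_compose[OF Qth_kernel[OF t] measurable_distr_prob_space[OF coord]] .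
    have d: "d \<in> borel_measurable (Hsp t)"
      unfolding d_def by (rule borel_measurable_KL[OF margQs margQth])
    have first: "first_KL T (qs t h) (qth t h) = d h" if h: "h \<in> space (Hsp t)" for h
    proof -
      have "marg (Qs t h) t = qs t h 1 (trunc T 1 (\<lambda>_. 0))"
        unfolding Qs_fact[OF t h] by (rule marg_to_time_ar_law[OF qs_kernel[OF t h] sigma_bij[OF t h] sigma_first[OF t h] t])
      moreover have "marg (Qth t h) t = qth t h 1 (trunc T 1 (\<lambda>_. 0))"
        unfolding Qth_fact[OF t h] by (rule marg_to_time_ar_law[OF qth_kernel[OF t h] sigma_bij[OF t h] sigma_first[OF t h] t])
      ultimately show ?thesis by (simp add: d_def first_KL_def)
    qed
    \<comment> \<open>Reordering into time is a common pushforward of both models, so data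
      processing already gives the needed direction.\<close>
    have comp: "KL (Qs t h) (Qth t h) \<le> ennreal (1 + c * ln (real T)) * d h"
      if h: "h \<in> space (Hsp t)" and ctrl: "\<forall>s\<in>{2..T}. step_KL T (qs t h) (qth t h) s
          \<le> ennreal (c / real s) * first_KL T (qs t h) (qth t h)" for h
    proof -
      have "KL (Qs t h) (Qth t h) \<le> KL (ar_law T (qs t h) T) (ar_law T (qth t h) T)"
        unfolding Qs_fact[OF t h] Qth_fact[OF t h]
        using qs_kernel[OF t h] qth_kernel[OF t h]
        by (intro KL_distr_le[where N="Dsp T"] ar_law_prob to_time_measurable sigma_bij[OF t h]) auto
      also have "\<dots> \<le> ennreal (1 + c * ln (real T)) * first_KL T (qs t h) (qth t h)"
        using qs_kernel[OF t h] qth_kernel[OF t h] T c ctrl by (intro KL_ar_law_le_first_KL) auto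
      finally show ?thesis by (simp add: first[OF h])
    qed
    \<comment> \<open>Off \<open>E\<close> the left side is 0. On \<open>E\<close> the action is
      \<open>B\<close>, and the support of the learned law supplies the bound on demand under the
      second argument.\<close>
    have obs: "d (H \<omega>) * indicator E \<omega>
        \<le> KL (obs_law (X t \<omega>) (marg (Qs t (H \<omega>)) t)) (obs_law (X t \<omega>) (marg (Qth t (H \<omega>)) t))"
      if \<omega>: "\<omega> \<in> space M" for \<omega>
    proof (cases "\<omega> \<in> E")
      case True
      have QH: "Qth t (H \<omega>) \<in> space (prob_algebra (Dsp T))"
        using measurable_space[OF Qth_kernel[OF t] Hs[OF \<omega>]] .
      note QH' = space_prob_algebraD[OF QH]
      interpret QH: prob_space "Qth t (H \<omega>)" by (rule QH'(1))
      have box: "PiE {1..T} (\<lambda>_. {0..B}) \<in> sets (Qth t (H \<omega>))"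
        by (simp add: QH'(2) Dsp_def sets_PiM_I_finite)
      have "AE y in Qth t (H \<omega>). y \<in> PiE {1..T} (\<lambda>_. {0..B})"
        using Qth_support[OF t Hs[OF \<omega>]] box by (subst QH.AE_in_set_eq_1) (auto simp: measure_def)
      then have "AE y in Qth t (H \<omega>). y t \<le> B"
        using t by (auto elim!: eventually_mono dest: PiE_mem)
      then have "AE x in marg (Qth t (H \<omega>)) t. x \<le> B"
        unfolding marg_def using coord by (subst AE_distr_iff) (auto simp: QH'(4))
      then have "d (H \<omega>) \<le> KL (obs_law B (marg (Qs t (H \<omega>)) t)) (obs_law B (marg (Qth t (H \<omega>)) t))"
        unfolding d_def
        using measurable_space[OF margQs Hs[OF \<omega>]] measurable_space[OF margQth Hs[OF \<omega>]]
        by (intro KL_le_KL_obs_law)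
      then show ?thesis using True by (simp add: E_def)
    qed simp
    \<comment> \<open>The point where measurability of \<open>d\<close> is indispensable; taking the
      whole path space for \<open>C\<close> in \<open>pi_law\<close> yields the conditional law of
      the action given the history alone.\<close>
    have explored: "ennreal \<eta> * (\<integral>\<^sup>+\<omega>. d (H \<omega>) \<partial>M) \<le> (\<integral>\<^sup>+\<omega>. d (H \<omega>) * indicator E \<omega> \<partial>M)"
    proof (rule nn_integral_conditional_prob_ge[OF M H E, where p="\<lambda>h. measure (\<pi> t h) {B}"])
      show "(\<lambda>h. measure (\<pi> t h) {B}) \<in> borel_measurable (Hsp t)"
        by (rule measurable_compose[OF pi_kernel[OF t] measurable_measure_prob_algebra]) simp
      have pi_prob: "prob_space (\<pi> t h)" if "h \<in> space (Hsp t)" for h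
        using measurable_space[OF pi_kernel[OF t] that] by (rule space_prob_algebraD)
      then show "0 \<le> measure (\<pi> t h) {B} \<and> measure (\<pi> t h) {B} \<le> 1" if "h \<in> space (Hsp t)" for h
        using that by (simp add: prob_space.prob_le_1)
      show "measure M {\<omega> \<in> space M. H \<omega> \<in> A \<and> \<omega> \<in> E} = (\<integral>\<omega>. indicator A (H \<omega>) * measure (\<pi> t (H \<omega>)) {B} \<partial>M)"
        if A: "A \<in> sets (Hsp t)" for A
      proof -
        have dp: "dpath T D \<omega> \<in> space (Dsp T)" for \<omega> by (simp add: dpath_def space_Dsp)
        then have "{\<omega> \<in> space M. H \<omega> \<in> A \<and> \<omega> \<in> E}
            = {\<omega> \<in> space M. H \<omega> \<in> A \<and> dpath T D \<omega> \<in> space (Dsp T) \<and> X t \<omega> \<in> {B}}"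
          by (auto simp: E_def)
        then show ?thesis
          using pi_law[OF t A sets.top[of "Dsp T"], of "{B}"] dp by (simp add: H_def)
      qed
      show "AE \<omega> in M. \<eta> \<le> measure (\<pi> t (H \<omega>)) {B}"
        using explore[OF t] AE_space
      proof eventually_elim
        case (elim \<omega>)
        interpret p: prob_space "\<pi> t (H \<omega>)" by (rule pi_prob[OF Hs[OF elim(2)]])
        show ?case using elim(1) by (simp add: H_def p.emeasure_eq_measure[unfolded H_def])
      qed
    qed (rule d)
    have "(\<integral>\<^sup>+ \<omega>. KL (Qs t (H \<omega>)) (Qth t (H \<omega>)) \<partial>M) \<le> (\<integral>\<^sup>+ \<omega>. ennreal (1 + c * ln (real T)) * d (H \<omega>) \<partial>M)"
    proof (rule nn_integral_mono_AE)
      show "AE \<omega> in M. KL (Qs t (H \<omega>)) (Qth t (H \<omega>)) \<le> ennreal (1 + c * ln (real T)) * d (H \<omega>)"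
        using step_control[OF t] AE_space
        by eventually_elim (use Hs comp in \<open>simp add: H_def\<close>)
    qed
    also have "\<dots> = ennreal (1 + c * ln (real T)) * (\<integral>\<^sup>+ \<omega>. d (H \<omega>) \<partial>M)"
      using measurable_compose[OF H d] by (rule nn_integral_cmult)
    \<comment> \<open>The factor \<open>\<eta>\<close> is split off to stand next to the integral of
      \<open>d\<close>, where \<open>explored\<close> absorbs it.\<close>
    also have "ennreal (1 + c * ln (real T)) = ennreal ((1 + c * ln (real T)) / \<eta>) * ennreal \<eta>"
      using eta K_nonneg by (simp add: ennreal_mult[symmetric])
    also have "\<dots> * (\<integral>\<^sup>+ \<omega>. d (H \<omega>) \<partial>M) \<le> ennreal ((1 + c * ln (real T)) / \<eta>) * (\<integral>\<^sup>+\<omega>. d (H \<omega>) * indicator E \<omega> \<partial>M)"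
      unfolding mult.assoc by (intro mult_left_mono explored) simp
    also have "\<dots> \<le> ennreal ((1 + c * ln (real T)) / \<eta>) *
        (\<integral>\<^sup>+ \<omega>. KL (obs_law (X t \<omega>) (marg (Qs t (H \<omega>)) t)) (obs_law (X t \<omega>) (marg (Qth t (H \<omega>)) t)) \<partial>M)"
      using obs by (intro mult_left_mono nn_integral_mono) auto
    finally show ?thesis unfolding H_def .
  qed
  then show ?thesis
    unfolding Delta_comp_def Delta_obs_def sum_distrib_left by (intro sum_mono)
qed

end
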